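(* Let $(M^n,g)$ be a Riemannian manifold carrying a conformal product structure with Lee form $\theta$ and orthogonal $D$-parallel splitting $TM=T_1\oplus T_2$, with $p=\operatorname{rank}T_1\ge2$, $q=\operatorname{rank}T_2\ge2$, $n=p+q$. Let $X\in T_1$ and $U\in T_2$, and let $e_1,\dots,e_p$ be a local orthonormal frame of $T_1$. Then $$d\theta(X,U)=\frac{n-2}{(p-1)(q-1)}\sum_{a=1}^p W(X,e_a,e_a,U).$$
   Context: Let $\nabla$ be the Levi-Civita connection of $g$. A Weyl connection on $(M,g)$ is a connection of the form $D_XY=\nabla_XY+\theta(Y)X+\theta(X)Y-g(X,Y)\theta^\sharp$ for a one-form $\theta$, called its Lee form. A conformal product structure on $(M,g)$ is a $g$-orthogonal splitting $TM=T_1\oplus T_2$ into distributions of constant rank together with a Weyl connection $D$ (the adapted Weyl connection) preserving both $T_1$ and $T_2$. Curvature convention: $R(X,Y)Z=\nabla_X\nabla_YZ-\nabla_Y\nabla_XZ-\nabla_{[X,Y]}Z$. $W$ is the Weyl tensor of $g$ (the totally trace-free part of $R$), written $W_{X,Y}Z$ with the same sign convention, and $W(X,Y,Z,V)=g(W_{X,Y}Z,V)$. $d\theta(X,Y)=X\theta(Y)-Y\theta(X)-\theta([X,Y])$. *)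

theory Defs
  imports "HOL-Analysis.Analysis"
begin

section \<open>Smooth manifolds\<close>

fun Ck_on :: "nat \<Rightarrow> 'e::euclidean_space set \<Rightarrow> ('e \<Rightarrow> 'f::real_normed_vector) \<Rightarrow> bool" where
  "Ck_on 0 S f \<longleftrightarrow> continuous_on S f"
| "Ck_on (Suc k) S f \<longleftrightarrow>
     (\<forall>x\<in>S. f differentiable (at x)) \<and> (\<forall>v. Ck_on k S (\<lambda>x. frechet_derivative f (at x) v))"

text \<open>Only used for open \<open>S\<close>.\<close>

definition smooth_on :: "'e::euclidean_space set \<Rightarrow> ('e \<Rightarrow> 'f::real_normed_vector) \<Rightarrow> bool" where
  "smooth_on S f \<longleftrightarrow> (\<forall>k. Ck_on k S f)"

text \<open>The underlying set is \<open>topspace (mtop M)\<close>; a chart is a pair of its domain and its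
  coordinate map; the dimension is \<open>DIM('e)\<close>.\<close>

record ('a, 'e) manifold =
  mtop :: "'a topology"
  charts :: "('a set \<times> ('a \<Rightarrow> 'e)) set"

definition smooth_manifold :: "('a, 'e::euclidean_space) manifold \<Rightarrow> bool" where
  "smooth_manifold M \<longleftrightarrow>
     Hausdorff_space (mtop M) \<and> second_countable (mtop M) \<and>
     (\<Union>(C, \<phi>)\<in>charts M. C) = topspace (mtop M) \<and>
     (\<forall>(C, \<phi>)\<in>charts M. openin (mtop M) C \<and> open (\<phi> ` C) \<and>
        homeomorphic_map (subtopology (mtop M) C) (top_of_set (\<phi> ` C)) \<phi>) \<and>
     (\<forall>(C, \<phi>)\<in>charts M. \<forall>(C', \<psi>)\<in>charts M.
        smooth_on (\<phi> ` (C \<inter> C')) (\<psi> \<circ> inv_into C \<phi>))"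

definition smooth_fun :: "('a, 'e::euclidean_space) manifold \<Rightarrow> 'a set \<Rightarrow> ('a \<Rightarrow> real) \<Rightarrow> bool" where
  "smooth_fun M V f \<longleftrightarrow>
     openin (mtop M) V \<and> (\<forall>(C, \<phi>)\<in>charts M. smooth_on (\<phi> ` (C \<inter> V)) (f \<circ> inv_into C \<phi>))"

definition smooth_fun_near :: "('a, 'e::euclidean_space) manifold \<Rightarrow> 'a \<Rightarrow> ('a \<Rightarrow> real) \<Rightarrow> bool" where
  "smooth_fun_near M x f \<longleftrightarrow> (\<exists>V. x \<in> V \<and> smooth_fun M V f)"

section \<open>Tangent vectors and vector fields\<close>

text \<open>Real-valued functionals on functions, as a vector space with pointwise operations. The
  tangent spaces are subspaces of it.\<close>

typedef 'a tvec = "UNIV :: (('a \<Rightarrow> real) \<Rightarrow> real) set"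
  morphisms tapp Tvec by simp

instantiation tvec :: (type) real_vector
begin
definition "0 = Tvec (\<lambda>_. 0)"
definition "v + w = Tvec (\<lambda>f. tapp v f + tapp w f)"
definition "- v = Tvec (\<lambda>f. - tapp v f)"
definition "v - w = Tvec (\<lambda>f. tapp v f - tapp w f)"
definition "c *\<^sub>R v = Tvec (\<lambda>f. c * tapp v f)"
instance
  by standard
    (simp_all add: zero_tvec_def plus_tvec_def uminus_tvec_def minus_tvec_def scaleR_tvec_def
      Tvec_inverse Tvec_inject tapp_inverse algebra_simps)
end

text \<open>Derivations at \<open>x\<close> of the algebra of functions that are smooth near \<open>x\<close>. Such a derivation
  depends only on the germ of \<open>f\<close> at \<open>x\<close>: if \<open>f\<close> vanishes on an open \<open>V\<close> containing \<open>x\<close>, then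
  \<open>f \<cdot> indicator V = 0\<close> and the Leibniz rule gives \<open>v f = 0\<close>. The last clause fixes the value on
  the remaining functions, so that vectors are equal when they agree as derivations.\<close>

definition tangent_space :: "('a, 'e::euclidean_space) manifold \<Rightarrow> 'a \<Rightarrow> 'a tvec set" where
  "tangent_space M x = {v.
     (\<forall>f h a b. smooth_fun_near M x f \<and> smooth_fun_near M x h \<longrightarrow>
        tapp v (\<lambda>y. a * f y + b * h y) = a * tapp v f + b * tapp v h \<and>
        tapp v (\<lambda>y. f y * h y) = tapp v f * h x + f x * tapp v h) \<and>
     (\<forall>f. \<not> smooth_fun_near M x f \<longrightarrow> tapp v f = 0)}"

definition smooth_vf :: "('a, 'e::euclidean_space) manifold \<Rightarrow> 'a set \<Rightarrow> ('a \<Rightarrow> 'a tvec) \<Rightarrow> bool" where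
  "smooth_vf M V X \<longleftrightarrow>
     openin (mtop M) V \<and> (\<forall>x\<in>V. X x \<in> tangent_space M x) \<and>
     (\<forall>W f. W \<subseteq> V \<and> smooth_fun M W f \<longrightarrow> smooth_fun M W (\<lambda>x. tapp (X x) f))"

definition smooth_vf_near :: "('a, 'e::euclidean_space) manifold \<Rightarrow> 'a \<Rightarrow> ('a \<Rightarrow> 'a tvec) \<Rightarrow> bool" where
  "smooth_vf_near M x X \<longleftrightarrow> (\<exists>V. x \<in> V \<and> smooth_vf M V X)"

definition lie_bracket ::
    "('a, 'e::euclidean_space) manifold \<Rightarrow> ('a \<Rightarrow> 'a tvec) \<Rightarrow> ('a \<Rightarrow> 'a tvec) \<Rightarrow> 'a \<Rightarrow> 'a tvec" where
  "lie_bracket M X Y x = Tvec (\<lambda>f. if smooth_fun_near M x f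
     then tapp (X x) (\<lambda>y. tapp (Y y) f) - tapp (Y x) (\<lambda>y. tapp (X y) f) else 0)"

section \<open>One-forms and metrics\<close>

definition one_form :: "('a, 'e::euclidean_space) manifold \<Rightarrow> ('a \<Rightarrow> 'a tvec \<Rightarrow> real) \<Rightarrow> bool" where
  "one_form M \<theta> \<longleftrightarrow>
     (\<forall>x\<in>topspace (mtop M). \<forall>v\<in>tangent_space M x. \<forall>w\<in>tangent_space M x. \<forall>a b.
        \<theta> x (a *\<^sub>R v + b *\<^sub>R w) = a * \<theta> x v + b * \<theta> x w) \<and>
     (\<forall>V X. smooth_vf M V X \<longrightarrow> smooth_fun M V (\<lambda>x. \<theta> x (X x)))"

definition ext_deriv :: "('a, 'e::euclidean_space) manifold \<Rightarrow> ('a \<Rightarrow> 'a tvec \<Rightarrow> real) \<Rightarrow>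
    ('a \<Rightarrow> 'a tvec) \<Rightarrow> ('a \<Rightarrow> 'a tvec) \<Rightarrow> 'a \<Rightarrow> real" where
  "ext_deriv M \<theta> X Y x = tapp (X x) (\<lambda>y. \<theta> y (Y y)) - tapp (Y x) (\<lambda>y. \<theta> y (X y))
     - \<theta> x (lie_bracket M X Y x)"

definition riemannian_metric ::
    "('a, 'e::euclidean_space) manifold \<Rightarrow> ('a \<Rightarrow> 'a tvec \<Rightarrow> 'a tvec \<Rightarrow> real) \<Rightarrow> bool" where
  "riemannian_metric M g \<longleftrightarrow>
     (\<forall>x\<in>topspace (mtop M). \<forall>v\<in>tangent_space M x.
        (\<forall>w\<in>tangent_space M x. g x v w = g x w v) \<and>
        (\<forall>u\<in>tangent_space M x. \<forall>w\<in>tangent_space M x. \<forall>a b.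
           g x (a *\<^sub>R u + b *\<^sub>R w) v = a * g x u v + b * g x w v) \<and>
        (v \<noteq> 0 \<longrightarrow> g x v v > 0)) \<and>
     (\<forall>V X Y. smooth_vf M V X \<and> smooth_vf M V Y \<longrightarrow> smooth_fun M V (\<lambda>x. g x (X x) (Y x)))"

definition sharp :: "('a, 'e::euclidean_space) manifold \<Rightarrow> ('a \<Rightarrow> 'a tvec \<Rightarrow> 'a tvec \<Rightarrow> real) \<Rightarrow>
    ('a \<Rightarrow> 'a tvec \<Rightarrow> real) \<Rightarrow> 'a \<Rightarrow> 'a tvec" where
  "sharp M g \<theta> x =
     (THE w. w \<in> tangent_space M x \<and> (\<forall>v\<in>tangent_space M x. g x w v = \<theta> x v))"

section \<open>Distributions and frames\<close>

definition distribution ::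
    "('a, 'e::euclidean_space) manifold \<Rightarrow> nat \<Rightarrow> ('a \<Rightarrow> 'a tvec set) \<Rightarrow> bool" where
  "distribution M k T \<longleftrightarrow>
     (\<forall>x\<in>topspace (mtop M). \<exists>V E. x \<in> V \<and> openin (mtop M) V \<and>
        (\<forall>i\<in>{1..k}. smooth_vf M V (E i)) \<and>
        (\<forall>y\<in>V. T y = span ((\<lambda>i. E i y) ` {1..k}) \<and> dim (T y) = k))"

definition orthonormal_frame :: "('a, 'e::euclidean_space) manifold \<Rightarrow>
    ('a \<Rightarrow> 'a tvec \<Rightarrow> 'a tvec \<Rightarrow> real) \<Rightarrow> ('a \<Rightarrow> 'a tvec set) \<Rightarrow> nat \<Rightarrow> 'a set \<Rightarrow>
    (nat \<Rightarrow> 'a \<Rightarrow> 'a tvec) \<Rightarrow> bool" where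
  "orthonormal_frame M g T k V e \<longleftrightarrow>
     openin (mtop M) V \<and> (\<forall>i\<in>{1..k}. smooth_vf M V (e i)) \<and>
     (\<forall>y\<in>V. T y = span ((\<lambda>i. e i y) ` {1..k}) \<and>
        (\<forall>i\<in>{1..k}. \<forall>j\<in>{1..k}. g y (e i y) (e j y) = (if i = j then 1 else 0)))"

section \<open>Connections and curvature\<close>

text \<open>\<open>N x v Y\<close> is the covariant derivative at \<open>x\<close> of the local field \<open>Y\<close> in the direction \<open>v\<close>.
  As for tangent vectors, the Leibniz rule makes it depend only on the germ of \<open>Y\<close>.\<close>

type_synonym 'a connection = "'a \<Rightarrow> 'a tvec \<Rightarrow> ('a \<Rightarrow> 'a tvec) \<Rightarrow> 'a tvec"

definition is_connection :: "('a, 'e::euclidean_space) manifold \<Rightarrow> 'a connection \<Rightarrow> bool" where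
  "is_connection M N \<longleftrightarrow>
     (\<forall>x\<in>topspace (mtop M). \<forall>v\<in>tangent_space M x. \<forall>Y. smooth_vf_near M x Y \<longrightarrow>
        N x v Y \<in> tangent_space M x \<and>
        (\<forall>w\<in>tangent_space M x. \<forall>a b. N x (a *\<^sub>R v + b *\<^sub>R w) Y = a *\<^sub>R N x v Y + b *\<^sub>R N x w Y) \<and>
        (\<forall>Z. smooth_vf_near M x Z \<longrightarrow> N x v (\<lambda>y. Y y + Z y) = N x v Y + N x v Z) \<and>
        (\<forall>f. smooth_fun_near M x f \<longrightarrow>
           N x v (\<lambda>y. f y *\<^sub>R Y y) = tapp v f *\<^sub>R Y x + f x *\<^sub>R N x v Y)) \<and>
     (\<forall>V X Y. smooth_vf M V X \<and> smooth_vf M V Y \<longrightarrow> smooth_vf M V (\<lambda>x. N x (X x) Y))"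

definition levi_civita :: "('a, 'e::euclidean_space) manifold \<Rightarrow>
    ('a \<Rightarrow> 'a tvec \<Rightarrow> 'a tvec \<Rightarrow> real) \<Rightarrow> 'a connection \<Rightarrow> bool" where
  "levi_civita M g N \<longleftrightarrow> is_connection M N \<and>
     (\<forall>V X Y. smooth_vf M V X \<and> smooth_vf M V Y \<longrightarrow>
        (\<forall>x\<in>V. N x (X x) Y - N x (Y x) X = lie_bracket M X Y x)) \<and>
     (\<forall>V X Y Z. smooth_vf M V X \<and> smooth_vf M V Y \<and> smooth_vf M V Z \<longrightarrow>
        (\<forall>x\<in>V. tapp (X x) (\<lambda>y. g y (Y y) (Z y)) = g x (N x (X x) Y) (Z x) + g x (Y x) (N x (X x) Z)))"

definition curvature :: "('a, 'e::euclidean_space) manifold \<Rightarrow> 'a connection \<Rightarrow>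
    ('a \<Rightarrow> 'a tvec) \<Rightarrow> ('a \<Rightarrow> 'a tvec) \<Rightarrow> ('a \<Rightarrow> 'a tvec) \<Rightarrow> 'a \<Rightarrow> 'a tvec" where
  "curvature M N X Y Z x =
     N x (X x) (\<lambda>y. N y (Y y) Z) - N x (Y x) (\<lambda>y. N y (X y) Z) - N x (lie_bracket M X Y x) Z"

text \<open>Traces are taken in an arbitrary orthonormal frame of the tangent bundle near the point; they
  do not depend on this choice.\<close>

definition onframe_at :: "('a, 'e::euclidean_space) manifold \<Rightarrow>
    ('a \<Rightarrow> 'a tvec \<Rightarrow> 'a tvec \<Rightarrow> real) \<Rightarrow> 'a \<Rightarrow> nat \<Rightarrow> 'a \<Rightarrow> 'a tvec" where
  "onframe_at M g x =
     (SOME E. \<exists>V. x \<in> V \<and> orthonormal_frame M g (tangent_space M) DIM('e) V E)"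

definition ricci :: "('a, 'e::euclidean_space) manifold \<Rightarrow>
    ('a \<Rightarrow> 'a tvec \<Rightarrow> 'a tvec \<Rightarrow> real) \<Rightarrow> 'a connection \<Rightarrow>
    ('a \<Rightarrow> 'a tvec) \<Rightarrow> ('a \<Rightarrow> 'a tvec) \<Rightarrow> 'a \<Rightarrow> real" where
  "ricci M g N Y Z x = (let E = onframe_at M g x in
     \<Sum>i=1..DIM('e). g x (curvature M N (E i) Y Z x) (E i x))"

definition scalar_curvature :: "('a, 'e::euclidean_space) manifold \<Rightarrow>
    ('a \<Rightarrow> 'a tvec \<Rightarrow> 'a tvec \<Rightarrow> real) \<Rightarrow> 'a connection \<Rightarrow> 'a \<Rightarrow> real" where
  "scalar_curvature M g N x = (let E = onframe_at M g x in
     \<Sum>i=1..DIM('e). ricci M g N (E i) (E i) x)"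

text \<open>The totally trace-free part of the curvature tensor \<open>R(X, Y, Z, V) = g(R(X, Y)Z, V)\<close>, by the
  standard formula, for dimension at least 3. The signs are those of the convention in which the
  unit sphere has \<open>R(X, Y)Z = g(Y, Z)X - g(X, Z)Y\<close>.\<close>

definition weyl :: "('a, 'e::euclidean_space) manifold \<Rightarrow>
    ('a \<Rightarrow> 'a tvec \<Rightarrow> 'a tvec \<Rightarrow> real) \<Rightarrow> 'a connection \<Rightarrow>
    ('a \<Rightarrow> 'a tvec) \<Rightarrow> ('a \<Rightarrow> 'a tvec) \<Rightarrow> ('a \<Rightarrow> 'a tvec) \<Rightarrow> ('a \<Rightarrow> 'a tvec) \<Rightarrow> 'a \<Rightarrow> real" where
  "weyl M g N X Y Z V x = (let n = real DIM('e); G = (\<lambda>A B. g x (A x) (B x));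
       Ric = (\<lambda>A B. ricci M g N A B x); s = scalar_curvature M g N x in
     g x (curvature M N X Y Z x) (V x)
     - (Ric Y Z * G X V - Ric X Z * G Y V + G Y Z * Ric X V - G X Z * Ric Y V) / (n - 2)
     + s * (G Y Z * G X V - G X Z * G Y V) / ((n - 1) * (n - 2)))"

section \<open>Conformal product structures\<close>

definition weyl_connection :: "('a, 'e::euclidean_space) manifold \<Rightarrow>
    ('a \<Rightarrow> 'a tvec \<Rightarrow> 'a tvec \<Rightarrow> real) \<Rightarrow> 'a connection \<Rightarrow> ('a \<Rightarrow> 'a tvec \<Rightarrow> real) \<Rightarrow>
    'a connection \<Rightarrow> bool" where
  "weyl_connection M g N \<theta> D \<longleftrightarrow> one_form M \<theta> \<and> is_connection M D \<and>
     (\<forall>x\<in>topspace (mtop M). \<forall>v\<in>tangent_space M x. \<forall>Y. smooth_vf_near M x Y \<longrightarrow>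
        D x v Y = N x v Y + \<theta> x (Y x) *\<^sub>R v + \<theta> x v *\<^sub>R Y x - g x v (Y x) *\<^sub>R sharp M g \<theta> x)"

definition preserves :: "('a, 'e::euclidean_space) manifold \<Rightarrow> 'a connection \<Rightarrow>
    ('a \<Rightarrow> 'a tvec set) \<Rightarrow> bool" where
  "preserves M D T \<longleftrightarrow>
     (\<forall>V Y. smooth_vf M V Y \<and> (\<forall>y\<in>V. Y y \<in> T y) \<longrightarrow>
        (\<forall>x\<in>V. \<forall>v\<in>tangent_space M x. D x v Y \<in> T x))"

definition conformal_product_structure :: "('a, 'e::euclidean_space) manifold \<Rightarrow>
    ('a \<Rightarrow> 'a tvec \<Rightarrow> 'a tvec \<Rightarrow> real) \<Rightarrow> 'a connection \<Rightarrow> ('a \<Rightarrow> 'a tvec \<Rightarrow> real) \<Rightarrow>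
    'a connection \<Rightarrow> nat \<Rightarrow> ('a \<Rightarrow> 'a tvec set) \<Rightarrow> nat \<Rightarrow> ('a \<Rightarrow> 'a tvec set) \<Rightarrow> bool" where
  "conformal_product_structure M g N \<theta> D p T1 q T2 \<longleftrightarrow>
     distribution M p T1 \<and> distribution M q T2 \<and>
     (\<forall>x\<in>topspace (mtop M).
        tangent_space M x = {v + w |v w. v \<in> T1 x \<and> w \<in> T2 x} \<and> T1 x \<inter> T2 x = {0} \<and>
        (\<forall>v\<in>T1 x. \<forall>w\<in>T2 x. g x v w = 0)) \<and>
     weyl_connection M g N \<theta> D \<and> preserves M D T1 \<and> preserves M D T2"

end

theory Submission
  imports Defs
begin

text \<open>
  Since \<open>D\<close> preserves \<open>T\<^sub>1\<close>, the formula for \<open>D - \<nabla>\<close> shows that \<open>T\<^sub>1\<close> is totally umbilic with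
  mean curvature vector the normal part of \<open>\<theta>\<^sup>\<sharp>\<close>: for \<open>Y, Z\<close> in \<open>T\<^sub>1\<close>, the field
  \<open>\<nabla>\<^sub>YZ - g(Y,Z) \<theta>\<^sup>\<sharp>\<close> lies again in \<open>T\<^sub>1\<close> (\<open>nabla_residue_in\<close>). Differentiating once more gives a
  Codazzi equation (\<open>curvature_normal_component\<close>): for \<open>X, Y, Z\<close> in \<open>T\<^sub>1\<close> and \<open>u\<close> normal to \<open>T\<^sub>1\<close>,

  \<open>g(R(X,Y)Z, u) = g(Y,Z) h(X,u) - g(X,Z) h(Y,u)\<close>,
  where \<open>h(v,w) = (\<nabla>\<^sub>v\<theta>)(w) - \<theta>(v) \<theta>(w)\<close> (\<open>lee_hessian\<close>).

  Tracing over an orthonormal frame \<open>e\<^sub>a\<close> of \<open>T\<^sub>1\<close> yields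
  \<open>A = \<Sum>\<^sub>a R(X,e\<^sub>a,e\<^sub>a,U) = (p - 1) h(X,U)\<close>, and the same argument in \<open>T\<^sub>2\<close> with a frame \<open>f\<^sub>b\<close> yields
  \<open>B = \<Sum>\<^sub>b R(U,f\<^sub>b,f\<^sub>b,X) = (q - 1) h(U,X)\<close> (\<open>curvature_partial_trace\<close>). The product \<open>\<theta>(v) \<theta>(w)\<close> is
  symmetric and \<open>\<nabla>\<close> is torsion-free, so \<open>d\<theta>(X,U) = h(X,U) - h(U,X) = A / (p - 1) - B / (q - 1)\<close>.

  On the other side, the two frames together compute \<open>Ric(X,U) = A + B\<close> by the symmetries of \<open>R\<close>.
  As \<open>X\<close> and \<open>U\<close> are orthogonal, the only Ricci terms that survive in \<open>\<Sum>\<^sub>a W(X,e\<^sub>a,e\<^sub>a,U)\<close> add up to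
  \<open>(p - 1) Ric(X,U)\<close>, and the sum is
  \<open>A - (p - 1) (A + B) / (n - 2) = ((q - 1) A - (p - 1) B) / (n - 2)\<close>, which is
  \<open>(p - 1) (q - 1) d\<theta>(X,U) / (n - 2)\<close>.

  This needs the curvature of \<open>\<nabla>\<close> as a tensor with its symmetries, and smooth orthonormal frames,
  in which the Ricci curvature can be computed. The frames exist by Gram--Schmidt
  (\<open>gram_schmidt\<close>): frames of \<open>T\<^sub>1\<close> and \<open>T\<^sub>2\<close> together form a frame of the tangent bundle with
  \<open>p + q = n\<close> members.
\<close>

section \<open>Smooth functions\<close>

lemma Ck_on_subset: "Ck_on k S f \<Longrightarrow> T \<subseteq> S \<Longrightarrow> Ck_on k T f"
  by (induction k arbitrary: f) (auto intro: continuous_on_subset)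

lemma Ck_on_Suc_imp: "Ck_on (Suc k) S f \<Longrightarrow> Ck_on k S f"
proof (induction k arbitrary: f)
  case 0
  then show ?case
    by (auto intro!: continuous_at_imp_continuous_on differentiable_imp_continuous_within)
next
  case (Suc k)
  show ?case unfolding Ck_on.simps(2)[of k]
  proof (intro conjI allI)
    show "\<forall>x\<in>S. f differentiable (at x)" using Suc.prems by simp
    show "Ck_on k S (\<lambda>x. frechet_derivative f (at x) v)" for v
      using Suc.prems by (intro Suc.IH) (subst (asm) Ck_on.simps(2), blast)
  qed
qed

lemma Ck_on_cong:
  assumes "open S" "\<And>x. x \<in> S \<Longrightarrow> f x = h x" "Ck_on k S f"
  shows "Ck_on k S h"
  using assms(2,3)
proof (induction k arbitrary: f h)
  case 0
  then show ?case using continuous_on_cong[of S S f h] by simp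
next
  case (Suc k)
  have *: "(h has_derivative frechet_derivative f (at x)) (at x)" if "x \<in> S" for x
    using has_derivative_transform_within_open[of f _ x UNIV S h] Suc.prems assms(1) that
    by (simp add: frechet_derivative_works)
  have **: "frechet_derivative h (at x) = frechet_derivative f (at x)" if "x \<in> S" for x
    using *[OF that] by (rule frechet_derivative_at[symmetric])
  have "Ck_on k S (\<lambda>x. frechet_derivative h (at x) v)" for v
    using Suc.IH[of "\<lambda>x. frechet_derivative f (at x) v"] Suc.prems(2) ** by simp
  then show ?case using * by (auto simp: differentiable_def)
qed

lemma Ck_on_const: "open S \<Longrightarrow> Ck_on k S (\<lambda>_. c)"
  by (induction k arbitrary: c) auto

lemma Ck_on_add:
  assumes "open S" "Ck_on k S f" "Ck_on k S h"
  shows "Ck_on k S (\<lambda>x. f x + h x)"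
  using assms(2,3)
proof (induction k arbitrary: f h)
  case 0
  then show ?case by (auto intro: continuous_on_add)
next
  case (Suc k)
  have *: "((\<lambda>x. f x + h x) has_derivative
      (\<lambda>v. frechet_derivative f (at x) v + frechet_derivative h (at x) v)) (at x)"
    if "x \<in> S" for x
    using Suc.prems that by (intro has_derivative_add) (simp_all add: frechet_derivative_works)
  have "Ck_on k S (\<lambda>x. frechet_derivative (\<lambda>x. f x + h x) (at x) v)" for v
  proof (rule Ck_on_cong[OF assms(1)])
    show "Ck_on k S (\<lambda>x. frechet_derivative f (at x) v + frechet_derivative h (at x) v)"
      using Suc by simp
    show "frechet_derivative f (at x) v + frechet_derivative h (at x) v
        = frechet_derivative (\<lambda>x. f x + h x) (at x) v" if "x \<in> S" for x
      by (rule fun_cong[OF frechet_derivative_at[OF *[OF that]]])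
  qed
  then show ?case using * by (auto simp: differentiable_def)
qed

lemma Ck_on_mult:
  fixes f h :: "'e::euclidean_space \<Rightarrow> real"
  assumes "open S" "Ck_on k S f" "Ck_on k S h"
  shows "Ck_on k S (\<lambda>x. f x * h x)"
  using assms(2,3)
proof (induction k arbitrary: f h)
  case 0
  then show ?case by (auto intro: continuous_on_mult)
next
  case (Suc k)
  have *: "((\<lambda>x. f x * h x) has_derivative
      (\<lambda>v. f x * frechet_derivative h (at x) v + frechet_derivative f (at x) v * h x)) (at x)"
    if "x \<in> S" for x
    using Suc.prems that by (intro has_derivative_mult) (simp_all add: frechet_derivative_works)
  have "Ck_on k S (\<lambda>x. frechet_derivative (\<lambda>x. f x * h x) (at x) v)" for v
  proof (rule Ck_on_cong[OF assms(1)])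
    show "Ck_on k S (\<lambda>x. f x * frechet_derivative h (at x) v + frechet_derivative f (at x) v * h x)"
      using Suc by (intro Ck_on_add assms Suc.IH Ck_on_Suc_imp[of k S f] Ck_on_Suc_imp[of k S h])
        simp_all
    show "f x * frechet_derivative h (at x) v + frechet_derivative f (at x) v * h x
        = frechet_derivative (\<lambda>x. f x * h x) (at x) v" if "x \<in> S" for x
      by (rule fun_cong[OF frechet_derivative_at[OF *[OF that]]])
  qed
  then show ?case using * by (auto simp: differentiable_def)
qed

text \<open>All exponents are treated at once because the derivative of \<open>f\<^sup>a\<close> involves \<open>f\<^sup>a\<^sup>-\<^sup>1\<close>.\<close>

lemma Ck_on_powr:
  fixes f :: "'e::euclidean_space \<Rightarrow> real"
  assumes "open S" "\<And>x. x \<in> S \<Longrightarrow> f x > 0" "Ck_on k S f"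
  shows "Ck_on k S (\<lambda>x. f x powr a)"
  using assms(3)
proof (induction k arbitrary: a)
  case 0
  then have "continuous_on S f" by simp
  moreover have "\<forall>x\<in>S. f x \<noteq> 0" using assms(2) by force
  ultimately show ?case by (simp add: continuous_on_powr)
next
  case (Suc k)
  have *: "((\<lambda>x. f x powr a) has_derivative
      (\<lambda>v. a * f x powr (a - 1) * frechet_derivative f (at x) v)) (at x)"
    if "x \<in> S" for x
  proof -
    have "(f has_derivative frechet_derivative f (at x)) (at x)"
      using Suc.prems that by (simp add: frechet_derivative_works)
    moreover have "((\<lambda>y. y powr a) has_derivative (*) (a * f x powr (a - 1))) (at (f x))"
      using has_real_derivative_powr[of "f x" a] assms(2)[OF that]
      by (simp add: has_field_derivative_def)
    ultimately show ?thesis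
      by (rule has_derivative_compose)
  qed
  have "Ck_on k S (\<lambda>x. frechet_derivative (\<lambda>x. f x powr a) (at x) v)" for v
  proof (rule Ck_on_cong[OF assms(1)])
    show "Ck_on k S (\<lambda>x. a * f x powr (a - 1) * frechet_derivative f (at x) v)"
      using Suc Ck_on_Suc_imp[of k S f]
      by (intro Ck_on_mult Ck_on_const assms Suc.IH) simp_all
    show "a * f x powr (a - 1) * frechet_derivative f (at x) v
        = frechet_derivative (\<lambda>x. f x powr a) (at x) v" if "x \<in> S" for x
      by (rule fun_cong[OF frechet_derivative_at[OF *[OF that]]])
  qed
  then show ?case using * by (auto simp: differentiable_def)
qed

locale smooth_mfd =
  fixes M :: "('a, 'e::euclidean_space) manifold"
  assumes smooth_manifold: "smooth_manifold M"
begin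

lemma chart_properties:
  assumes "(C, \<phi>) \<in> charts M"
  shows "openin (mtop M) C" "open (\<phi> ` C)"
    "homeomorphic_map (subtopology (mtop M) C) (top_of_set (\<phi> ` C)) \<phi>"
proof -
  have "\<forall>(C, \<phi>)\<in>charts M. openin (mtop M) C \<and> open (\<phi> ` C) \<and>
        homeomorphic_map (subtopology (mtop M) C) (top_of_set (\<phi> ` C)) \<phi>"
    using smooth_manifold unfolding smooth_manifold_def by (elim conjE)
  from bspec[OF this assms] show "openin (mtop M) C" "open (\<phi> ` C)"
    "homeomorphic_map (subtopology (mtop M) C) (top_of_set (\<phi> ` C)) \<phi>"
    by simp_all
qed

lemma chart_inj:
  assumes "(C, \<phi>) \<in> charts M" shows "inj_on \<phi> C"
proof -
  have "openin (mtop M) C" "homeomorphic_map (subtopology (mtop M) C) (top_of_set (\<phi> ` C)) \<phi>"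
    using chart_properties[OF assms] by auto
  then show ?thesis
    using homeomorphic_imp_injective_map topspace_subtopology_subset[OF openin_subset] by metis
qed

lemma chart_image_open:
  assumes "(C, \<phi>) \<in> charts M" "openin (mtop M) V" shows "open (\<phi> ` (C \<inter> V))"
proof -
  have 1: "homeomorphic_map (subtopology (mtop M) C) (top_of_set (\<phi> ` C)) \<phi>" "open (\<phi> ` C)"
    using chart_properties[OF assms(1)] by auto
  have "openin (subtopology (mtop M) C) (C \<inter> V)"
    using assms(2) by (metis openin_subtopology_Int2)
  then have "openin (top_of_set (\<phi> ` C)) (\<phi> ` (C \<inter> V))"
    using homeomorphic_imp_open_map[OF 1(1)] by (simp add: open_map_def)
  then show ?thesis using 1(2) by (rule openin_open_trans)
qed

lemma smooth_fun_cong: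
  assumes "smooth_fun M V f" "\<And>y. y \<in> V \<Longrightarrow> f y = h y"
  shows "smooth_fun M V h"
  unfolding smooth_fun_def smooth_on_def
proof (intro conjI ballI, goal_cases)
  case 1
  then show ?case using assms by (simp add: smooth_fun_def)
next
  case (2 c)
  obtain C \<phi> where c: "c = (C, \<phi>)" by fastforce
  have "Ck_on k (\<phi> ` (C \<inter> V)) (h \<circ> inv_into C \<phi>)" for k
  proof (rule Ck_on_cong)
    show "open (\<phi> ` (C \<inter> V))" using 2 assms c by (intro chart_image_open) (auto simp: smooth_fun_def)
    show "Ck_on k (\<phi> ` (C \<inter> V)) (f \<circ> inv_into C \<phi>)"
      using 2 assms c by (auto simp: smooth_fun_def smooth_on_def)
    show "(f \<circ> inv_into C \<phi>) x = (h \<circ> inv_into C \<phi>) x" if "x \<in> \<phi> ` (C \<inter> V)" for x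
      using that assms(2) chart_inj 2 c by auto
  qed
  then show ?case using c by simp
qed

lemma smooth_fun_subset:
  "smooth_fun M V f \<Longrightarrow> openin (mtop M) W \<Longrightarrow> W \<subseteq> V \<Longrightarrow> smooth_fun M W f"
  unfolding smooth_fun_def smooth_on_def
  by (clarsimp, rule Ck_on_subset) (blast, blast)

lemma smooth_fun_const: "openin (mtop M) V \<Longrightarrow> smooth_fun M V (\<lambda>_. c)"
  using chart_image_open unfolding smooth_fun_def smooth_on_def comp_def by (auto intro: Ck_on_const)

lemma smooth_fun_add:
  "smooth_fun M V f \<Longrightarrow> smooth_fun M V h \<Longrightarrow> smooth_fun M V (\<lambda>y. f y + h y)"
  using chart_image_open unfolding smooth_fun_def smooth_on_def comp_def
  by (auto intro!: Ck_on_add)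

lemma smooth_fun_mult:
  "smooth_fun M V f \<Longrightarrow> smooth_fun M V h \<Longrightarrow> smooth_fun M V (\<lambda>y. f y * h y)"
  using chart_image_open unfolding smooth_fun_def smooth_on_def comp_def
  by (auto intro!: Ck_on_mult)

lemma smooth_fun_powr:
  assumes "smooth_fun M V f" "\<And>y. y \<in> V \<Longrightarrow> f y > 0"
  shows "smooth_fun M V (\<lambda>y. f y powr a)"
proof -
  have "Ck_on k (\<phi> ` (C \<inter> V)) (\<lambda>z. f (inv_into C \<phi> z) powr a)" if c: "(C, \<phi>) \<in> charts M" for C \<phi> k
  proof (rule Ck_on_powr)
    show "open (\<phi> ` (C \<inter> V))" using c assms by (auto intro!: chart_image_open simp: smooth_fun_def)
    show "Ck_on k (\<phi> ` (C \<inter> V)) (\<lambda>z. f (inv_into C \<phi> z))"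
      using c assms by (auto simp: smooth_fun_def smooth_on_def comp_def)
    show "0 < f (inv_into C \<phi> z)" if "z \<in> \<phi> ` (C \<inter> V)" for z
      using that assms(2) chart_inj[OF c] by auto
  qed
  then show ?thesis using assms(1) by (auto simp: smooth_fun_def smooth_on_def comp_def)
qed

end

section \<open>Tangent vectors and vector fields\<close>

lemma tapp_simps [simp]:
  "tapp 0 f = 0"
  "tapp (v + w) f = tapp v f + tapp w f"
  "tapp (v - w) f = tapp v f - tapp w f"
  "tapp (- v) f = - tapp v f"
  "tapp (c *\<^sub>R v) f = c * tapp v f"
  by (simp_all add: zero_tvec_def plus_tvec_def minus_tvec_def uminus_tvec_def scaleR_tvec_def
      Tvec_inverse)

lemma tvec_eqI: "(\<And>f. tapp v f = tapp w f) \<Longrightarrow> v = w"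
  by (metis ext tapp_inject)

lemma subspace_tangent_space: "subspace (tangent_space M x)"
  by (auto simp: subspace_def tangent_space_def algebra_simps)

lemmas tangent_closed [simp, intro] =
  subspace_0[OF subspace_tangent_space] subspace_add[OF subspace_tangent_space]
  subspace_diff[OF subspace_tangent_space] subspace_scale[OF subspace_tangent_space]
  subspace_neg[OF subspace_tangent_space]

lemma tangent_sum [simp, intro]:
  "(\<And>i. i \<in> I \<Longrightarrow> v i \<in> tangent_space M x) \<Longrightarrow> (\<Sum>i\<in>I. v i) \<in> tangent_space M x"
  by (rule subspace_sum[OF subspace_tangent_space])

lemma smooth_fun_nearI: "smooth_fun M V f \<Longrightarrow> x \<in> V \<Longrightarrow> smooth_fun_near M x f"
  by (auto simp: smooth_fun_near_def)

lemma smooth_vf_nearI: "smooth_vf M V X \<Longrightarrow> x \<in> V \<Longrightarrow> smooth_vf_near M x X"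
  by (auto simp: smooth_vf_near_def)

lemma smooth_fun_openin: "smooth_fun M V f \<Longrightarrow> openin (mtop M) V"
  by (simp add: smooth_fun_def)

lemma smooth_vf_openin: "smooth_vf M V X \<Longrightarrow> openin (mtop M) V"
  by (simp add: smooth_vf_def)

lemma smooth_vf_tangent: "smooth_vf M V X \<Longrightarrow> x \<in> V \<Longrightarrow> X x \<in> tangent_space M x"
  by (simp add: smooth_vf_def)

lemma smooth_vf_topspace: "smooth_vf M V X \<Longrightarrow> x \<in> V \<Longrightarrow> x \<in> topspace (mtop M)"
  using smooth_vf_openin openin_subset by blast

lemma smooth_vf_tapp: "smooth_vf M V X \<Longrightarrow> smooth_fun M V f \<Longrightarrow> smooth_fun M V (\<lambda>y. tapp (X y) f)"
  by (simp add: smooth_vf_def)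

lemma smooth_vf_subset: "smooth_vf M V X \<Longrightarrow> openin (mtop M) W \<Longrightarrow> W \<subseteq> V \<Longrightarrow> smooth_vf M W X"
  unfolding smooth_vf_def by (meson subset_iff)

lemma tapp_lie_bracket:
  assumes "smooth_fun M V f" "x \<in> V"
  shows "tapp (lie_bracket M X Y x) f =
    tapp (X x) (\<lambda>y. tapp (Y y) f) - tapp (Y x) (\<lambda>y. tapp (X y) f)"
  using smooth_fun_nearI[OF assms] by (simp add: lie_bracket_def Tvec_inverse)

lemma lie_bracket_swap: "lie_bracket M X Y x = - lie_bracket M Y X x"
  by (rule tvec_eqI) (simp add: lie_bracket_def Tvec_inverse)

lemma tangent_spaceD:
  assumes "v \<in> tangent_space M x" "smooth_fun_near M x f" "smooth_fun_near M x h"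
  shows "tapp v (\<lambda>y. a * f y + b * h y) = a * tapp v f + b * tapp v h"
    "tapp v (\<lambda>y. f y * h y) = tapp v f * h x + f x * tapp v h"
proof -
  from assms(1) have "\<forall>f h a b. smooth_fun_near M x f \<and> smooth_fun_near M x h \<longrightarrow>
        tapp v (\<lambda>y. a * f y + b * h y) = a * tapp v f + b * tapp v h \<and>
        tapp v (\<lambda>y. f y * h y) = tapp v f * h x + f x * tapp v h"
    unfolding tangent_space_def mem_Collect_eq by (rule conjunct1)
  note * = this[rule_format, OF conjI[OF assms(2,3)]]
  show "tapp v (\<lambda>y. a * f y + b * h y) = a * tapp v f + b * tapp v h"
    by (rule conjunct1[OF *])
  show "tapp v (\<lambda>y. f y * h y) = tapp v f * h x + f x * tapp v h"
    by (rule conjunct2[OF *])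
qed

context smooth_mfd
begin

lemma tapp_mult:
  assumes "v \<in> tangent_space M x" "smooth_fun M V f" "smooth_fun M V h" "x \<in> V"
  shows "tapp v (\<lambda>y. f y * h y) = tapp v f * h x + f x * tapp v h"
  by (rule tangent_spaceD(2)[OF assms(1) assms(2,3)[THEN smooth_fun_nearI, OF assms(4)]])

text \<open>A derivation at \<open>x\<close> sees only the germ at \<open>x\<close>: if \<open>f\<close> and \<open>h\<close> agree on \<open>V\<close>, then their
  products with the indicator of \<open>V\<close> are the same function.\<close>

lemma tapp_local:
  assumes "v \<in> tangent_space M x" "smooth_fun M V f" "x \<in> V" "\<And>y. y \<in> V \<Longrightarrow> f y = h y"
  shows "tapp v f = tapp v h"
proof -
  let ?c = "indicator V :: 'a \<Rightarrow> real"
  have c: "smooth_fun M V ?c"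
    by (rule smooth_fun_cong[OF smooth_fun_const[OF smooth_fun_openin[OF assms(2)], of 1]]) simp
  have h: "smooth_fun M V h" using smooth_fun_cong assms by blast
  have "(\<lambda>y. f y * ?c y) = (\<lambda>y. h y * ?c y)"
    using assms(4) by (auto simp: indicator_def)
  then have "tapp v f * ?c x + f x * tapp v ?c = tapp v h * ?c x + h x * tapp v ?c"
    using tapp_mult[OF assms(1,2) c assms(3)] tapp_mult[OF assms(1) h c assms(3)] by metis
  then show ?thesis using assms(3,4) by simp
qed

lemma tapp_add:
  assumes "v \<in> tangent_space M x" "smooth_fun M V f" "smooth_fun M V h" "x \<in> V"
  shows "tapp v (\<lambda>y. f y + h y) = tapp v f + tapp v h"
  using tangent_spaceD(1)[OF assms(1) assms(2,3)[THEN smooth_fun_nearI, OF assms(4)], of 1 "1"]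
  by simp

lemma tapp_diff:
  assumes "v \<in> tangent_space M x" "smooth_fun M V f" "smooth_fun M V h" "x \<in> V"
  shows "tapp v (\<lambda>y. f y - h y) = tapp v f - tapp v h"
  using tangent_spaceD(1)[OF assms(1) assms(2,3)[THEN smooth_fun_nearI, OF assms(4)], of 1 "-1"]
  by simp

lemma smooth_fun_diff:
  assumes "smooth_fun M V f" "smooth_fun M V h" shows "smooth_fun M V (\<lambda>y. f y - h y)"
  using smooth_fun_add[OF assms(1)
      smooth_fun_mult[OF smooth_fun_const[OF smooth_fun_openin[OF assms(1)], of "-1"] assms(2)]]
  by simp

lemma smooth_vf_cong:
  assumes X: "smooth_vf M V X" and eq: "\<And>y. y \<in> V \<Longrightarrow> X y = Y y"
  shows "smooth_vf M V Y"
  unfolding smooth_vf_def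
proof (intro conjI ballI allI impI)
  show "openin (mtop M) V" using X by (rule smooth_vf_openin)
  show "Y x \<in> tangent_space M x" if "x \<in> V" for x
    using smooth_vf_tangent[OF X that] eq[OF that] by simp
  fix W f assume W: "W \<subseteq> V \<and> smooth_fun M W f"
  then have "smooth_fun M W (\<lambda>x. tapp (X x) f)"
    using X unfolding smooth_vf_def by blast
  then show "smooth_fun M W (\<lambda>x. tapp (Y x) f)"
    using W eq by (elim smooth_fun_cong) auto
qed

lemma smooth_vf_zero: "openin (mtop M) V \<Longrightarrow> smooth_vf M V (\<lambda>_. 0)"
  unfolding smooth_vf_def by (auto intro: smooth_fun_const smooth_fun_openin)

lemma smooth_vf_add:
  assumes "smooth_vf M V X" "smooth_vf M V Y" shows "smooth_vf M V (\<lambda>y. X y + Y y)"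
  using assms unfolding smooth_vf_def by (auto intro!: smooth_fun_add)

lemma smooth_vf_scale:
  assumes "smooth_fun M V c" "smooth_vf M V X" shows "smooth_vf M V (\<lambda>y. c y *\<^sub>R X y)"
  unfolding smooth_vf_def
proof (intro conjI ballI allI impI)
  show "openin (mtop M) V" using assms(1) by (rule smooth_fun_openin)
  show "c x *\<^sub>R X x \<in> tangent_space M x" if "x \<in> V" for x
    using smooth_vf_tangent[OF assms(2) that] by simp
  fix W f assume W: "W \<subseteq> V \<and> smooth_fun M W f"
  then have "smooth_fun M W (\<lambda>x. tapp (X x) f)"
    using assms(2) unfolding smooth_vf_def by blast
  moreover have "smooth_fun M W c"
    using W assms(1) smooth_fun_subset smooth_fun_openin by blast
  ultimately show "smooth_fun M W (\<lambda>x. tapp (c x *\<^sub>R X x) f)"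
    by (simp add: smooth_fun_mult)
qed

lemma smooth_vf_scale_const:
  "smooth_vf M V X \<Longrightarrow> smooth_vf M V (\<lambda>y. c *\<^sub>R X y)"
  by (rule smooth_vf_scale[OF smooth_fun_const[OF smooth_vf_openin]])

lemma smooth_vf_diff:
  assumes "smooth_vf M V X" "smooth_vf M V Y" shows "smooth_vf M V (\<lambda>y. X y - Y y)"
  using smooth_vf_add[OF assms(1) smooth_vf_scale_const[OF assms(2), of "-1"]] by simp

lemma smooth_vf_sum:
  assumes "openin (mtop M) V" "\<And>i. i \<in> I \<Longrightarrow> smooth_vf M V (X i)"
  shows "smooth_vf M V (\<lambda>y. \<Sum>i\<in>I. X i y)"
  using assms(2)
  by (induction I rule: infinite_finite_induct)
    (auto intro: smooth_vf_zero smooth_vf_add assms(1))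

text \<open>Applied to a function smooth near \<open>x\<close>, each double bracket expands into four third-order
  derivatives, and the twelve cancel in pairs. On all other functions brackets are 0 by definition.\<close>

lemma lie_bracket_jacobi:
  assumes X: "smooth_vf M V X" and Y: "smooth_vf M V Y" and Z: "smooth_vf M V Z" and x: "x \<in> V"
  shows "lie_bracket M X (lie_bracket M Y Z) x + lie_bracket M Y (lie_bracket M Z X) x
    + lie_bracket M Z (lie_bracket M X Y) x = 0"
proof (rule tvec_eqI)
  fix f :: "'a \<Rightarrow> real"
  show "tapp (lie_bracket M X (lie_bracket M Y Z) x + lie_bracket M Y (lie_bracket M Z X) x
    + lie_bracket M Z (lie_bracket M X Y) x) f = tapp 0 f"
  proof (cases "smooth_fun_near M x f")
    case False
    then show ?thesis by (simp add: lie_bracket_def Tvec_inverse)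
  next
    case True
    then obtain V' where V': "x \<in> V'" "smooth_fun M V' f" by (auto simp: smooth_fun_near_def)
    define W where "W = V \<inter> V'"
    have W: "openin (mtop M) W" "x \<in> W"
      using V' x smooth_vf_openin[OF X] smooth_fun_openin[OF V'(2)] by (auto simp: W_def)
    have f: "smooth_fun M W f" using smooth_fun_subset[OF V'(2) W(1)] by (simp add: W_def)
    have XYZ: "smooth_vf M W X" "smooth_vf M W Y" "smooth_vf M W Z"
      using smooth_vf_subset[OF _ W(1)] X Y Z by (auto simp: W_def)
    have expand: "tapp (lie_bracket M A (lie_bracket M B C) x) f =
        (tapp (A x) (\<lambda>y. tapp (B y) (\<lambda>z. tapp (C z) f)) - tapp (A x) (\<lambda>y. tapp (C y) (\<lambda>z. tapp (B z) f)))
        - (tapp (B x) (\<lambda>y. tapp (C y) (\<lambda>z. tapp (A z) f)) - tapp (C x) (\<lambda>y. tapp (B y) (\<lambda>z. tapp (A z) f)))"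
      if A: "smooth_vf M W A" and B: "smooth_vf M W B" and C: "smooth_vf M W C" for A B C
    proof -
      have s: "smooth_fun M W (\<lambda>y. tapp (B y) (\<lambda>z. tapp (C z) f))"
        "smooth_fun M W (\<lambda>y. tapp (C y) (\<lambda>z. tapp (B z) f))"
        using A B C f by (auto intro: smooth_vf_tapp)
      have "tapp (A x) (\<lambda>y. tapp (lie_bracket M B C y) f)
          = tapp (A x) (\<lambda>y. tapp (B y) (\<lambda>z. tapp (C z) f) - tapp (C y) (\<lambda>z. tapp (B z) f))"
        by (rule tapp_local[OF smooth_vf_tangent[OF A W(2)] smooth_fun_diff[OF s] W(2), symmetric])
          (simp add: tapp_lie_bracket[OF f])
      also have "\<dots> = tapp (A x) (\<lambda>y. tapp (B y) (\<lambda>z. tapp (C z) f))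
          - tapp (A x) (\<lambda>y. tapp (C y) (\<lambda>z. tapp (B z) f))"
        by (rule tapp_diff[OF smooth_vf_tangent[OF A W(2)] s W(2)])
      finally show ?thesis
        by (simp add: tapp_lie_bracket[OF f W(2)] tapp_lie_bracket[OF smooth_vf_tapp[OF A f] W(2)])
    qed
    show ?thesis by (simp add: expand XYZ)
  qed
qed

end

section \<open>Metrics and orthonormal frames\<close>

locale riemannian = smooth_mfd M for M :: "('a, 'e::euclidean_space) manifold" +
  fixes g :: "'a \<Rightarrow> 'a tvec \<Rightarrow> 'a tvec \<Rightarrow> real"
  assumes riemannian_metric: "riemannian_metric M g"
begin

lemma metric_at:
  assumes "x \<in> topspace (mtop M)" "v \<in> tangent_space M x"
  shows "\<And>w. w \<in> tangent_space M x \<Longrightarrow> g x v w = g x w v"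
    and "\<And>u w a b. u \<in> tangent_space M x \<Longrightarrow> w \<in> tangent_space M x \<Longrightarrow>
           g x (a *\<^sub>R u + b *\<^sub>R w) v = a * g x u v + b * g x w v"
    and "v \<noteq> 0 \<Longrightarrow> g x v v > 0"
  using riemannian_metric assms unfolding riemannian_metric_def by blast+

lemma smooth_metric:
  "smooth_vf M V X \<Longrightarrow> smooth_vf M V Y \<Longrightarrow> smooth_fun M V (\<lambda>x. g x (X x) (Y x))"
  using riemannian_metric by (simp add: riemannian_metric_def)

context
  fixes x assumes x: "x \<in> topspace (mtop M)"
begin

lemma metric_sym: "v \<in> tangent_space M x \<Longrightarrow> w \<in> tangent_space M x \<Longrightarrow> g x v w = g x w v"
  by (rule metric_at(1)[OF x])

lemma metric_add_left:
  assumes "u \<in> tangent_space M x" "w \<in> tangent_space M x" "v \<in> tangent_space M x"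
  shows "g x (u + w) v = g x u v + g x w v"
  using metric_at(2)[OF x assms(3,1,2), of 1 1] by simp

lemma metric_diff_left:
  assumes "u \<in> tangent_space M x" "w \<in> tangent_space M x" "v \<in> tangent_space M x"
  shows "g x (u - w) v = g x u v - g x w v"
  using metric_at(2)[OF x assms(3,1,2), of 1 "-1"] by simp

lemma metric_scale_left:
  assumes "u \<in> tangent_space M x" "v \<in> tangent_space M x"
  shows "g x (c *\<^sub>R u) v = c * g x u v"
  using metric_at(2)[OF x assms(2,1,1), of c 0] by simp

lemma metric_minus_left:
  assumes "u \<in> tangent_space M x" "v \<in> tangent_space M x"
  shows "g x (- u) v = - g x u v"
  using metric_scale_left[OF assms, of "-1"] by simp

lemma metric_zero_left: "v \<in> tangent_space M x \<Longrightarrow> g x 0 v = 0"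
  using metric_scale_left[of 0 v 0] by simp

lemma metric_sum_left:
  assumes "\<And>i. i \<in> I \<Longrightarrow> u i \<in> tangent_space M x" "v \<in> tangent_space M x"
  shows "g x (\<Sum>i\<in>I. u i) v = (\<Sum>i\<in>I. g x (u i) v)"
  using assms
  by (induction I rule: infinite_finite_induct) (auto simp: metric_zero_left metric_add_left)

lemma metric_add_right:
  assumes "u \<in> tangent_space M x" "w \<in> tangent_space M x" "v \<in> tangent_space M x"
  shows "g x v (u + w) = g x v u + g x v w"
  using metric_add_left[OF assms] assms by (simp add: metric_sym)

lemma metric_diff_right:
  assumes "u \<in> tangent_space M x" "w \<in> tangent_space M x" "v \<in> tangent_space M x"
  shows "g x v (u - w) = g x v u - g x v w"
  using metric_diff_left[OF assms] assms by (simp add: metric_sym)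

lemma metric_scale_right:
  assumes "u \<in> tangent_space M x" "v \<in> tangent_space M x"
  shows "g x v (c *\<^sub>R u) = c * g x v u"
  using metric_scale_left[OF assms] assms by (simp add: metric_sym)

lemma metric_minus_right:
  assumes "u \<in> tangent_space M x" "v \<in> tangent_space M x"
  shows "g x v (- u) = - g x v u"
  using metric_minus_left[OF assms] assms by (simp add: metric_sym)

lemma metric_zero_right: "v \<in> tangent_space M x \<Longrightarrow> g x v 0 = 0"
  using metric_zero_left[of v] metric_sym[of v 0] by simp

lemma metric_sum_right:
  assumes "\<And>i. i \<in> I \<Longrightarrow> u i \<in> tangent_space M x" "v \<in> tangent_space M x"
  shows "g x v (\<Sum>i\<in>I. u i) = (\<Sum>i\<in>I. g x v (u i))"
  using assms
  by (induction I rule: infinite_finite_induct) (auto simp: metric_zero_right metric_add_right)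

lemmas metric_simps =
  metric_add_left metric_diff_left metric_scale_left metric_minus_left metric_zero_left
  metric_add_right metric_diff_right metric_scale_right metric_minus_right metric_zero_right

lemma metric_eqI:
  assumes "v \<in> tangent_space M x" "w \<in> tangent_space M x"
    "\<And>u. u \<in> tangent_space M x \<Longrightarrow> g x v u = g x w u"
  shows "v = w"
proof (rule ccontr)
  assume "v \<noteq> w"
  then have "g x (v - w) (v - w) > 0"
    using metric_at(3)[OF x, of "v - w"] assms by simp
  moreover have "g x (v - w) (v - w) = 0"
    using metric_diff_left[of v w "v - w"] assms by simp
  ultimately show False by simp
qed

end

lemma frame_smooth:
  "orthonormal_frame M g T k V E \<Longrightarrow> i \<in> {1..k} \<Longrightarrow> smooth_vf M V (E i)"
  by (simp add: orthonormal_frame_def)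

lemma frame_openin: "orthonormal_frame M g T k V E \<Longrightarrow> openin (mtop M) V"
  by (simp add: orthonormal_frame_def)

lemma frame_metric:
  "orthonormal_frame M g T k V E \<Longrightarrow> y \<in> V \<Longrightarrow> i \<in> {1..k} \<Longrightarrow> j \<in> {1..k} \<Longrightarrow>
    g y (E i y) (E j y) = (if i = j then 1 else 0)"
  by (simp add: orthonormal_frame_def)

lemma frame_span:
  "orthonormal_frame M g T k V E \<Longrightarrow> y \<in> V \<Longrightarrow> T y = span ((\<lambda>i. E i y) ` {1..k})"
  by (simp add: orthonormal_frame_def)

lemma frame_in: "orthonormal_frame M g T k V E \<Longrightarrow> y \<in> V \<Longrightarrow> i \<in> {1..k} \<Longrightarrow> E i y \<in> T y"
  using frame_span by (metis image_eqI span_base)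

lemma frame_subspace: "orthonormal_frame M g T k V E \<Longrightarrow> y \<in> V \<Longrightarrow> subspace (T y)"
  using frame_span by (metis subspace_span)

lemma frame_subset:
  assumes "orthonormal_frame M g T k V E" "openin (mtop M) W" "W \<subseteq> V"
  shows "orthonormal_frame M g T k W E"
  using assms smooth_vf_subset[OF _ assms(2,3)] unfolding orthonormal_frame_def
  by (simp add: subset_iff)

lemma frame_tangent:
  assumes E: "orthonormal_frame M g T k V E" and y: "y \<in> V"
  shows "T y \<subseteq> tangent_space M y"
  unfolding frame_span[OF E y] using smooth_vf_tangent[OF frame_smooth[OF E] y]
  by (intro span_minimal subspace_tangent_space) auto

lemma frame_topspace: "orthonormal_frame M g T k V E \<Longrightarrow> y \<in> V \<Longrightarrow> y \<in> topspace (mtop M)"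
  using frame_openin openin_subset by blast

text \<open>The vectors for which the expansion holds form a subspace, and orthonormality puts the frame
  into it.\<close>

lemma frame_expansion:
  assumes E: "orthonormal_frame M g T k V E" and y: "y \<in> V" and v: "v \<in> T y"
  shows "v = (\<Sum>i=1..k. g y v (E i y) *\<^sub>R E i y)"
proof -
  note yt = frame_topspace[OF E y]
  have Et: "E i y \<in> tangent_space M y" if "i \<in> {1..k}" for i
    using smooth_vf_tangent[OF frame_smooth[OF E that] y] .
  let ?S = "{v \<in> tangent_space M y. v = (\<Sum>i=1..k. g y v (E i y) *\<^sub>R E i y)}"
  have "span ((\<lambda>i. E i y) ` {1..k}) \<subseteq> ?S"
  proof (rule span_minimal)
    show "(\<lambda>i. E i y) ` {1..k} \<subseteq> ?S"
    proof (clarify, intro CollectI conjI)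
      fix j assume j: "j \<in> {1..k}"
      show "E j y \<in> tangent_space M y" by (rule Et[OF j])
      have "(\<Sum>i=1..k. g y (E j y) (E i y) *\<^sub>R E i y) = (\<Sum>i=1..k. if j = i then E i y else 0)"
        using frame_metric[OF E y j] by (intro sum.cong) auto
      also have "\<dots> = E j y" using j by simp
      finally show "E j y = (\<Sum>i=1..k. g y (E j y) (E i y) *\<^sub>R E i y)" by simp
    qed
    show "subspace ?S"
      unfolding subspace_def
    proof (intro conjI ballI allI)
      show "0 \<in> ?S" using Et by (simp add: metric_simps yt)
      show "v + w \<in> ?S" if v: "v \<in> ?S" and w: "w \<in> ?S" for v w
      proof -
        have "(\<Sum>i=1..k. g y (v + w) (E i y) *\<^sub>R E i y)
            = (\<Sum>i=1..k. g y v (E i y) *\<^sub>R E i y) + (\<Sum>i=1..k. g y w (E i y) *\<^sub>R E i y)"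
          using v w Et by (simp add: metric_simps yt scaleR_add_left sum.distrib)
        then show ?thesis using v w by simp
      qed
      show "c *\<^sub>R v \<in> ?S" if v: "v \<in> ?S" for c v
      proof -
        have "(\<Sum>i=1..k. g y (c *\<^sub>R v) (E i y) *\<^sub>R E i y) = c *\<^sub>R (\<Sum>i=1..k. g y v (E i y) *\<^sub>R E i y)"
          unfolding scaleR_sum_right using v Et by (intro sum.cong) (auto simp: metric_simps yt)
        then show ?thesis using v by simp
      qed
    qed
  qed
  then show ?thesis using v frame_span[OF E y] by blast
qed

text \<open>The inverse length \<open>g(w,w)\<^sup>-\<^sup>1\<^sup>/\<^sup>2\<close> of the orthogonalized field \<open>w\<close> is smooth
  because \<open>w\<close> vanishes nowhere.\<close>

lemma gram_schmidt:
  assumes "openin (mtop M) V" "\<And>i. i \<in> {1..k} \<Longrightarrow> smooth_vf M V (F i)"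
    "\<And>y i. y \<in> V \<Longrightarrow> i \<in> {1..k} \<Longrightarrow> F i y \<notin> span ((\<lambda>j. F j y) ` {1..<i})"
  shows "\<exists>E. orthonormal_frame M g (\<lambda>y. span ((\<lambda>i. F i y) ` {1..k})) k V E"
  using assms
proof (induction k)
  case 0
  then show ?case by (simp add: orthonormal_frame_def)
next
  case (Suc k)
  then obtain E where E: "orthonormal_frame M g (\<lambda>y. span ((\<lambda>i. F i y) ` {1..k})) k V E"
    by fastforce
  note Es = frame_smooth[OF E]
  have Fs: "smooth_vf M V (F (Suc k))" using Suc.prems by simp
  define s where "s y = (\<Sum>i=1..k. g y (F (Suc k) y) (E i y) *\<^sub>R E i y)" for y
  define w where "w y = F (Suc k) y - s y" for y
  define c where "c y = g y (w y) (w y) powr (- 1 / 2)" for y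
  define E' where "E' = E(Suc k := (\<lambda>y. c y *\<^sub>R w y))"
  have s: "smooth_vf M V s" unfolding s_def[abs_def]
    using Es Fs by (intro smooth_vf_sum smooth_vf_scale smooth_metric Suc.prems(1)) auto
  have w: "smooth_vf M V w" unfolding w_def[abs_def] by (intro smooth_vf_diff Fs s)
  have s_span: "s y \<in> span ((\<lambda>i. F i y) ` {1..k})" if y: "y \<in> V" for y
    unfolding s_def by (intro span_sum span_scale) (rule frame_in[OF E y])
  have pos: "g y (w y) (w y) > 0" if y: "y \<in> V" for y
  proof -
    have "F (Suc k) y \<notin> span ((\<lambda>j. F j y) ` {1..<Suc k})"
      using Suc.prems(3)[OF y, of "Suc k"] by simp
    then have "w y \<noteq> 0"
      using s_span[OF y] unfolding w_def atLeastLessThanSuc_atLeastAtMost by auto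
    then show ?thesis
      using metric_at(3)[OF smooth_vf_topspace[OF w y] smooth_vf_tangent[OF w y]] by simp
  qed
  have c: "smooth_fun M V c" unfolding c_def[abs_def]
    by (intro smooth_fun_powr smooth_metric w pos)
  have c2: "c y * c y * g y (w y) (w y) = 1" if y: "y \<in> V" for y
  proof -
    have "c y * c y = g y (w y) (w y) powr (-1)"
      unfolding c_def powr_add[symmetric] by simp
    then show ?thesis using pos[OF y] by (simp add: powr_minus)
  qed
  have orth: "g y (w y) (E j y) = 0" if y: "y \<in> V" and j: "j \<in> {1..k}" for y j
  proof -
    note yt = smooth_vf_topspace[OF w y]
    note t = smooth_vf_tangent[OF Es y] smooth_vf_tangent[OF Fs y] smooth_vf_tangent[OF s y]
    have "g y (s y) (E j y) = (\<Sum>i=1..k. g y (F (Suc k) y) (E i y) * g y (E i y) (E j y))"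
      unfolding s_def using t(1) t(1)[OF j]
      by (subst metric_sum_left[OF yt]) (auto simp: metric_simps[OF yt] intro!: sum.cong)
    also have "\<dots> = (\<Sum>i=1..k. if i = j then g y (F (Suc k) y) (E i y) else 0)"
      using frame_metric[OF E y _ j] by (intro sum.cong) auto
    also have "\<dots> = g y (F (Suc k) y) (E j y)" using j by simp
    finally show ?thesis unfolding w_def using t j by (simp add: metric_simps[OF yt])
  qed
  have "orthonormal_frame M g (\<lambda>y. span ((\<lambda>i. F i y) ` {1..Suc k})) (Suc k) V E'"
    unfolding orthonormal_frame_def
  proof (intro conjI ballI)
    show "openin (mtop M) V" by (rule Suc.prems(1))
    show "smooth_vf M V (E' i)" if "i \<in> {1..Suc k}" for i
      using that Es smooth_vf_scale[OF c w] by (auto simp: E'_def)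
    fix y assume y: "y \<in> V"
    note yt = smooth_vf_topspace[OF w y]
    show "g y (E' i y) (E' j y) = (if i = j then 1 else 0)" if "i \<in> {1..Suc k}" "j \<in> {1..Suc k}" for i j
    proof -
      note t = smooth_vf_tangent[OF Es y] smooth_vf_tangent[OF w y]
      have "i \<in> {1..k} \<or> i = Suc k" "j \<in> {1..k} \<or> j = Suc k" using that by auto
      then show ?thesis
        using t orth[OF y] c2[OF y] frame_metric[OF E y]
        by (auto simp: E'_def metric_simps[OF yt] metric_sym[OF yt, of "E i y" "w y"])
    qed
    have 1: "(\<lambda>i. F i y) ` {1..Suc k} = insert (F (Suc k) y) ((\<lambda>i. F i y) ` {1..k})"
      by (simp add: atLeastAtMostSuc_conv)
    have 2: "(\<lambda>i. E' i y) ` {1..Suc k} = insert (c y *\<^sub>R w y) ((\<lambda>i. E i y) ` {1..k})"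
      by (auto simp: E'_def atLeastAtMostSuc_conv)
    have sp: "span ((\<lambda>i. F i y) ` {1..k}) = span ((\<lambda>i. E i y) ` {1..k})"
      by (rule frame_span[OF E y])
    have "c y \<noteq> 0" using pos[OF y] by (simp add: c_def)
    then have 4: "w y = (1 / c y) *\<^sub>R (c y *\<^sub>R w y)" by simp
    show "span ((\<lambda>i. F i y) ` {1..Suc k}) = span ((\<lambda>i. E' i y) ` {1..Suc k})"
      unfolding 1 2 span_eq
    proof (intro conjI; intro insert_subsetI)
      have "w y \<in> span (insert (c y *\<^sub>R w y) ((\<lambda>i. E i y) ` {1..k}))"
        by (subst 4) (intro span_scale span_base, simp)
      moreover have "s y \<in> span (insert (c y *\<^sub>R w y) ((\<lambda>i. E i y) ` {1..k}))"
        using s_span[OF y] sp span_mono[of "(\<lambda>i. E i y) ` {1..k}"] by blast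
      ultimately show "F (Suc k) y \<in> span (insert (c y *\<^sub>R w y) ((\<lambda>i. E i y) ` {1..k}))"
        using span_add[of "w y" _ "s y"] by (simp add: w_def)
      show "(\<lambda>i. F i y) ` {1..k} \<subseteq> span (insert (c y *\<^sub>R w y) ((\<lambda>i. E i y) ` {1..k}))"
        using sp span_superset[of "(\<lambda>i. F i y) ` {1..k}"] span_mono[of "(\<lambda>i. E i y) ` {1..k}"] by blast
      have "s y \<in> span (insert (F (Suc k) y) ((\<lambda>i. F i y) ` {1..k}))"
        using s_span[OF y] span_mono[of "(\<lambda>i. F i y) ` {1..k}"] by blast
      then show "c y *\<^sub>R w y \<in> span (insert (F (Suc k) y) ((\<lambda>i. F i y) ` {1..k}))"
        unfolding w_def by (intro span_scale span_diff) (auto intro: span_base)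
      show "(\<lambda>i. E i y) ` {1..k} \<subseteq> span (insert (F (Suc k) y) ((\<lambda>i. F i y) ` {1..k}))"
        using sp span_superset[of "(\<lambda>i. E i y) ` {1..k}"] span_mono[of "(\<lambda>i. F i y) ` {1..k}"] by blast
    qed
  qed
  then show ?case by blast
qed

text \<open>Gram--Schmidt applies to the given spanning fields: if one of them lay in the span of its
  predecessors, the other \<open>k - 1\<close> would already span \<open>T\<close>, whose dimension is \<open>k\<close>.\<close>

lemma distribution_orthonormal_frame:
  assumes "distribution M k T" "x \<in> topspace (mtop M)"
  obtains V E where "x \<in> V" "orthonormal_frame M g T k V E"
proof -
  obtain V F where V: "x \<in> V" "openin (mtop M) V" and F: "\<forall>i\<in>{1..k}. smooth_vf M V (F i)"
    and T: "\<forall>y\<in>V. T y = span ((\<lambda>i. F i y) ` {1..k}) \<and> dim (T y) = k"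
    using assms unfolding distribution_def by metis
  have indep: "F i y \<notin> span ((\<lambda>j. F j y) ` {1..<i})" if y: "y \<in> V" and i: "i \<in> {1..k}" for y i
  proof
    assume "F i y \<in> span ((\<lambda>j. F j y) ` {1..<i})"
    moreover have "(\<lambda>j. F j y) ` {1..<i} \<subseteq> (\<lambda>j. F j y) ` ({1..k} - {i})" using i by auto
    ultimately have "F i y \<in> span ((\<lambda>j. F j y) ` ({1..k} - {i}))"
      using span_mono by blast
    then have "F j y \<in> span ((\<lambda>j. F j y) ` ({1..k} - {i}))" if "j \<in> {1..k}" for j
      using that by (cases "j = i") (auto intro: span_base)
    then have "span ((\<lambda>j. F j y) ` {1..k}) \<subseteq> span ((\<lambda>j. F j y) ` ({1..k} - {i}))"
      by (intro span_minimal subspace_span image_subsetI)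
    then have "T y \<subseteq> span ((\<lambda>j. F j y) ` ({1..k} - {i}))"
      using T y by simp
    then have "dim (T y) \<le> card ((\<lambda>j. F j y) ` ({1..k} - {i}))"
      by (rule dim_le_card) simp
    also have "\<dots> \<le> card ({1..k} - {i})" by (rule card_image_le) simp
    also have "\<dots> < k" using i by simp
    finally have "dim (T y) < k" .
    moreover have "dim (T y) = k" using T y by blast
    ultimately show False by simp
  qed
  from gram_schmidt[OF V(2), of k F, OF F[rule_format] indep]
  obtain E where E: "orthonormal_frame M g (\<lambda>y. span ((\<lambda>i. F i y) ` {1..k})) k V E" by blast
  have "orthonormal_frame M g T k V E"
    using E T unfolding orthonormal_frame_def by simp
  with V show ?thesis using that by blast
qed

text \<open>The frame exhibits the dual vector as \<open>\<Sum>\<^sub>i \<theta>(E\<^sub>i) E\<^sub>i\<close>, so it exists and is smooth.\<close>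

lemma sharp_props:
  assumes E: "orthonormal_frame M g (tangent_space M) k V E" and th: "one_form M \<theta>"
  shows "smooth_vf M V (sharp M g \<theta>)"
    and "\<And>y v. y \<in> V \<Longrightarrow> v \<in> tangent_space M y \<Longrightarrow> g y (sharp M g \<theta> y) v = \<theta> y v"
proof -
  define s where "s y = (\<Sum>i=1..k. \<theta> y (E i y) *\<^sub>R E i y)" for y
  have ths: "smooth_fun M V (\<lambda>y. \<theta> y (X y))" if "smooth_vf M V X" for X
    using th that unfolding one_form_def by blast
  have s: "smooth_vf M V s"
    unfolding s_def[abs_def] using frame_smooth[OF E]
    by (intro smooth_vf_sum smooth_vf_scale ths frame_openin[OF E]) auto
  have dual: "g y (s y) v = \<theta> y v" if y: "y \<in> V" and v: "v \<in> tangent_space M y" for y v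
  proof -
    note yt = frame_topspace[OF E y]
    have Et: "E i y \<in> tangent_space M y" if "i \<in> {1..k}" for i
      using frame_in[OF E y that] .
    have lin: "\<theta> y (a *\<^sub>R u + b *\<^sub>R w) = a * \<theta> y u + b * \<theta> y w"
      if "u \<in> tangent_space M y" "w \<in> tangent_space M y" for a b u w
      using th yt that unfolding one_form_def by blast
    have lin_sum: "\<theta> y (\<Sum>i\<in>I. c i *\<^sub>R u i) = (\<Sum>i\<in>I. c i * \<theta> y (u i))"
      if "finite I" "\<And>i. i \<in> I \<Longrightarrow> u i \<in> tangent_space M y" for I c and u :: "nat \<Rightarrow> _"
      using that
    proof (induction I)
      case empty
      then show ?case using lin[of 0 0 0 0] by simp
    next
      case (insert i I)
      then show ?case using lin[of "u i" "\<Sum>i\<in>I. c i *\<^sub>R u i" "c i" 1] by simp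
    qed
    have "\<theta> y v = \<theta> y (\<Sum>i=1..k. g y v (E i y) *\<^sub>R E i y)"
      using frame_expansion[OF E y v] by simp
    also have "\<dots> = (\<Sum>i=1..k. g y v (E i y) * \<theta> y (E i y))"
      using Et by (intro lin_sum) auto
    also have "\<dots> = g y (s y) v"
      unfolding s_def using Et v
      by (subst metric_sum_left[OF yt])
        (auto simp: metric_simps[OF yt] metric_sym[OF yt _ v] intro!: sum.cong)
    finally show ?thesis by simp
  qed
  have eq: "s y = sharp M g \<theta> y" if y: "y \<in> V" for y
    unfolding sharp_def
  proof (rule the_equality[symmetric])
    show "s y \<in> tangent_space M y \<and> (\<forall>v\<in>tangent_space M y. g y (s y) v = \<theta> y v)"
      using smooth_vf_tangent[OF s y] dual[OF y] by blast
    show "w = s y" if "w \<in> tangent_space M y \<and> (\<forall>v\<in>tangent_space M y. g y w v = \<theta> y v)" for w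
      using that dual[OF y] smooth_vf_tangent[OF s y]
      by (intro metric_eqI[OF frame_topspace[OF E y]]) auto
  qed
  show "smooth_vf M V (sharp M g \<theta>)" using smooth_vf_cong[OF s] eq by blast
  show "g y (sharp M g \<theta> y) v = \<theta> y v" if "y \<in> V" "v \<in> tangent_space M y" for y v
    using dual[OF that] eq[OF that(1)] by simp
qed

end

section \<open>The Levi-Civita connection\<close>

locale levi_civita_mfd = riemannian M g
  for M :: "('a, 'e::euclidean_space) manifold" and g +
  fixes nabla :: "'a connection"
  assumes levi_civita: "levi_civita M g nabla"
begin

lemma nabla_smooth:
  "smooth_vf M V X \<Longrightarrow> smooth_vf M V Y \<Longrightarrow> smooth_vf M V (\<lambda>x. nabla x (X x) Y)"
  using levi_civita by (simp add: levi_civita_def is_connection_def)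

lemma lie_bracket_torsion_free:
  assumes "smooth_vf M V X" "smooth_vf M V Y" "x \<in> V"
  shows "lie_bracket M X Y x = nabla x (X x) Y - nabla x (Y x) X"
  using levi_civita assms unfolding levi_civita_def by metis

lemma metric_compatible:
  assumes "smooth_vf M V X" "smooth_vf M V Y" "smooth_vf M V Z" "x \<in> V"
  shows "tapp (X x) (\<lambda>y. g y (Y y) (Z y)) = g x (nabla x (X x) Y) (Z x) + g x (Y x) (nabla x (X x) Z)"
  using levi_civita assms unfolding levi_civita_def by simp

text \<open>Torsion-freeness replaces computations with derivations: the bracket is a difference of
  covariant derivatives.\<close>

lemma smooth_lie_bracket:
  assumes "smooth_vf M V X" "smooth_vf M V Y"
  shows "smooth_vf M V (lie_bracket M X Y)"
  by (rule smooth_vf_cong[OF smooth_vf_diff[OF nabla_smooth[OF assms] nabla_smooth[OF assms(2,1)]]])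
    (simp add: lie_bracket_torsion_free[OF assms])

context
  fixes V x v Y
  assumes x: "x \<in> V" and v: "v \<in> tangent_space M x" and Y: "smooth_vf M V Y"
begin

text \<open>The axioms of a connection ask for smoothness near \<open>x\<close>, for each field separately; here all
  fields are smooth on one open set \<open>V\<close>.\<close>

lemma
  shows nabla_tangent: "nabla x v Y \<in> tangent_space M x"
    and nabla_lin: "w \<in> tangent_space M x \<Longrightarrow>
      nabla x (a *\<^sub>R v + b *\<^sub>R w) Y = a *\<^sub>R nabla x v Y + b *\<^sub>R nabla x w Y"
    and nabla_add: "smooth_vf M V Z \<Longrightarrow> nabla x v (\<lambda>y. Y y + Z y) = nabla x v Y + nabla x v Z"
    and nabla_leibniz: "smooth_fun M V f \<Longrightarrow>
      nabla x v (\<lambda>y. f y *\<^sub>R Y y) = tapp v f *\<^sub>R Y x + f x *\<^sub>R nabla x v Y"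
proof -
  have "\<forall>x\<in>topspace (mtop M). \<forall>v\<in>tangent_space M x. \<forall>Y. smooth_vf_near M x Y \<longrightarrow>
        nabla x v Y \<in> tangent_space M x \<and>
        (\<forall>w\<in>tangent_space M x. \<forall>a b.
           nabla x (a *\<^sub>R v + b *\<^sub>R w) Y = a *\<^sub>R nabla x v Y + b *\<^sub>R nabla x w Y) \<and>
        (\<forall>Z. smooth_vf_near M x Z \<longrightarrow> nabla x v (\<lambda>y. Y y + Z y) = nabla x v Y + nabla x v Z) \<and>
        (\<forall>f. smooth_fun_near M x f \<longrightarrow>
           nabla x v (\<lambda>y. f y *\<^sub>R Y y) = tapp v f *\<^sub>R Y x + f x *\<^sub>R nabla x v Y)"
    using levi_civita unfolding levi_civita_def is_connection_def by (elim conjE)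
  note * = this[rule_format, OF smooth_vf_topspace[OF Y x] v smooth_vf_nearI[OF Y x]]
  show "nabla x v Y \<in> tangent_space M x" by (rule conjunct1[OF *])
  show "nabla x (a *\<^sub>R v + b *\<^sub>R w) Y = a *\<^sub>R nabla x v Y + b *\<^sub>R nabla x w Y"
    if "w \<in> tangent_space M x"
    by (rule conjunct1[OF conjunct2[OF *], rule_format, OF that])
  show "nabla x v (\<lambda>y. Y y + Z y) = nabla x v Y + nabla x v Z" if "smooth_vf M V Z"
    by (rule conjunct1[OF conjunct2[OF conjunct2[OF *]], rule_format, OF smooth_vf_nearI[OF that x]])
  show "nabla x v (\<lambda>y. f y *\<^sub>R Y y) = tapp v f *\<^sub>R Y x + f x *\<^sub>R nabla x v Y" if "smooth_fun M V f"
    by (rule conjunct2[OF conjunct2[OF conjunct2[OF *]], rule_format, OF smooth_fun_nearI[OF that x]])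
qed

lemma nabla_dir_add: "w \<in> tangent_space M x \<Longrightarrow> nabla x (v + w) Y = nabla x v Y + nabla x w Y"
  using nabla_lin[of w 1 1] by simp

lemma nabla_dir_diff: "w \<in> tangent_space M x \<Longrightarrow> nabla x (v - w) Y = nabla x v Y - nabla x w Y"
  using nabla_lin[of w 1 "-1"] by simp

lemma nabla_dir_scale: "nabla x (c *\<^sub>R v) Y = c *\<^sub>R nabla x v Y"
  using nabla_lin[of v c 0] v by simp

lemma nabla_dir_minus: "nabla x (- v) Y = - nabla x v Y"
  using nabla_dir_scale[of "-1"] by simp

lemma nabla_dir_zero: "nabla x 0 Y = 0"
  using nabla_dir_scale[of 0] by simp

end

text \<open>As for derivations, multiplication by the indicator of \<open>V\<close> shows that \<open>\<nabla>\<^sub>vY\<close> sees only the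
  germ of \<open>Y\<close>.\<close>

lemma nabla_local:
  assumes x: "x \<in> V" and v: "v \<in> tangent_space M x" and Y: "smooth_vf M V Y"
    and eq: "\<And>y. y \<in> V \<Longrightarrow> Y y = Z y"
  shows "nabla x v Y = nabla x v Z"
proof -
  let ?c = "indicator V :: 'a \<Rightarrow> real"
  have c: "smooth_fun M V ?c"
    by (rule smooth_fun_cong[OF smooth_fun_const[OF smooth_vf_openin[OF Y], of 1]]) simp
  have Z: "smooth_vf M V Z" by (rule smooth_vf_cong[OF Y eq])
  have "(\<lambda>y. ?c y *\<^sub>R Y y) = (\<lambda>y. ?c y *\<^sub>R Z y)"
    by (rule ext) (metis eq indicator_simps(2) scaleR_zero_left)
  then have "tapp v ?c *\<^sub>R Y x + ?c x *\<^sub>R nabla x v Y = tapp v ?c *\<^sub>R Z x + ?c x *\<^sub>R nabla x v Z"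
    using nabla_leibniz[OF x v Y c] nabla_leibniz[OF x v Z c] by simp
  then show ?thesis using x eq[OF x] by simp
qed

lemma nabla_diff:
  assumes x: "x \<in> V" and v: "v \<in> tangent_space M x" and Y: "smooth_vf M V Y" and Z: "smooth_vf M V Z"
  shows "nabla x v (\<lambda>y. Y y - Z y) = nabla x v Y - nabla x v Z"
  using nabla_add[OF x v smooth_vf_diff[OF Y Z] Z] by simp

lemma nabla_dir_sum:
  assumes x: "x \<in> V" and Y: "smooth_vf M V Y" and v: "\<And>i. i \<in> I \<Longrightarrow> v i \<in> tangent_space M x"
  shows "nabla x (\<Sum>i\<in>I. v i) Y = (\<Sum>i\<in>I. nabla x (v i) Y)"
  using v
proof (induction I rule: infinite_finite_induct)
  case (insert i I)
  then show ?case by (simp add: nabla_dir_add[OF x _ Y] tangent_sum)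
qed (simp_all add: nabla_dir_zero[OF x tangent_closed(1) Y])

section \<open>Symmetries of the curvature\<close>

lemma curvature_tangent:
  assumes "smooth_vf M V X" "smooth_vf M V Y" "smooth_vf M V Z" "x \<in> V"
  shows "curvature M nabla X Y Z x \<in> tangent_space M x"
  unfolding curvature_def using assms
  by (intro tangent_closed nabla_tangent[of x V] nabla_smooth smooth_lie_bracket smooth_vf_tangent)
    (auto intro: smooth_lie_bracket smooth_vf_tangent[of M V])

lemma curvature_swap:
  assumes X: "smooth_vf M V X" and Y: "smooth_vf M V Y" and Z: "smooth_vf M V Z" and x: "x \<in> V"
  shows "curvature M nabla X Y Z x = - curvature M nabla Y X Z x"
  unfolding curvature_def lie_bracket_swap[of M X Y]
  using nabla_dir_minus[OF x smooth_vf_tangent[OF smooth_lie_bracket[OF Y X] x] Z] by simp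

text \<open>Second derivatives of \<open>g(Z,W)\<close> commute up to the bracket, and the mixed terms \<open>g(\<nabla>\<^sub>YZ, \<nabla>\<^sub>XW)\<close> cancel.\<close>

lemma curvature_skew:
  assumes X: "smooth_vf M V X" and Y: "smooth_vf M V Y" and Z: "smooth_vf M V Z"
    and W: "smooth_vf M V W" and x: "x \<in> V"
  shows "g x (curvature M nabla X Y Z x) (W x) = - g x (curvature M nabla X Y W x) (Z x)"
proof -
  note xt = smooth_vf_topspace[OF X x]
  note tan = smooth_vf_tangent[OF _ x]
  have second: "tapp (A x) (\<lambda>y. tapp (B y) (\<lambda>z. g z (Z z) (W z))) =
      g x (nabla x (A x) (\<lambda>y. nabla y (B y) Z)) (W x) + g x (nabla x (B x) Z) (nabla x (A x) W)
      + (g x (nabla x (A x) Z) (nabla x (B x) W) + g x (Z x) (nabla x (A x) (\<lambda>y. nabla y (B y) W)))"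
    if A: "smooth_vf M V A" and B: "smooth_vf M V B" for A B
  proof -
    note BZ = nabla_smooth[OF B Z] and BW = nabla_smooth[OF B W]
    have "tapp (A x) (\<lambda>y. tapp (B y) (\<lambda>z. g z (Z z) (W z))) =
        tapp (A x) (\<lambda>y. g y (nabla y (B y) Z) (W y) + g y (Z y) (nabla y (B y) W))"
      by (rule tapp_local[OF tan[OF A] smooth_vf_tapp[OF B smooth_metric[OF Z W]] x])
        (rule metric_compatible[OF B Z W])
    also have "\<dots> = tapp (A x) (\<lambda>y. g y (nabla y (B y) Z) (W y))
        + tapp (A x) (\<lambda>y. g y (Z y) (nabla y (B y) W))"
      by (rule tapp_add[OF tan[OF A] smooth_metric[OF BZ W] smooth_metric[OF Z BW] x])
    finally show ?thesis
      using metric_compatible[OF A BZ W x] metric_compatible[OF A Z BW x] by simp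
  qed
  note bX = smooth_lie_bracket[OF X Y]
  have "tapp (lie_bracket M X Y x) (\<lambda>z. g z (Z z) (W z)) =
      tapp (X x) (\<lambda>y. tapp (Y y) (\<lambda>z. g z (Z z) (W z)))
      - tapp (Y x) (\<lambda>y. tapp (X y) (\<lambda>z. g z (Z z) (W z)))"
    by (rule tapp_lie_bracket[OF smooth_metric[OF Z W] x])
  then have "g x (nabla x (lie_bracket M X Y x) Z) (W x) + g x (Z x) (nabla x (lie_bracket M X Y x) W)
     = g x (nabla x (X x) (\<lambda>y. nabla y (Y y) Z)) (W x) + g x (Z x) (nabla x (X x) (\<lambda>y. nabla y (Y y) W))
     - (g x (nabla x (Y x) (\<lambda>y. nabla y (X y) Z)) (W x) + g x (Z x) (nabla x (Y x) (\<lambda>y. nabla y (X y) W)))"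
    unfolding second[OF X Y] second[OF Y X] metric_compatible[OF bX Z W x] by simp
  moreover
  have t: "nabla x (X x) (\<lambda>y. nabla y (Y y) Z) \<in> tangent_space M x"
    "nabla x (Y x) (\<lambda>y. nabla y (X y) Z) \<in> tangent_space M x"
    "nabla x (lie_bracket M X Y x) Z \<in> tangent_space M x"
    "nabla x (X x) (\<lambda>y. nabla y (Y y) W) \<in> tangent_space M x"
    "nabla x (Y x) (\<lambda>y. nabla y (X y) W) \<in> tangent_space M x"
    "nabla x (lie_bracket M X Y x) W \<in> tangent_space M x"
    by (intro nabla_tangent[OF x] tan nabla_smooth X Y Z W bX)+
  ultimately show ?thesis
    unfolding curvature_def using tan[OF Z] tan[OF W]
    by (simp add: metric_simps[OF xt] metric_sym[OF xt _ tan[OF Z]])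
qed

text \<open>Torsion-freeness gives \<open>\<nabla>\<^sub>A\<nabla>\<^sub>BC - \<nabla>\<^sub>A\<nabla>\<^sub>CB = [A,[B,C]] + \<nabla>\<^bsub>[B,C]\<^esub>A\<close>. In the cyclic sum the last
  terms cancel against those of the curvature, and the double brackets satisfy the Jacobi identity.\<close>

lemma curvature_bianchi:
  assumes X: "smooth_vf M V X" and Y: "smooth_vf M V Y" and Z: "smooth_vf M V Z" and x: "x \<in> V"
  shows "curvature M nabla X Y Z x + curvature M nabla Y Z X x + curvature M nabla Z X Y x = 0"
proof -
  have pair: "nabla x (A x) (\<lambda>y. nabla y (B y) C) - nabla x (A x) (\<lambda>y. nabla y (C y) B)
      = lie_bracket M A (lie_bracket M B C) x + nabla x (lie_bracket M B C x) A"
    if A: "smooth_vf M V A" and B: "smooth_vf M V B" and C: "smooth_vf M V C" for A B C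
  proof -
    note At = smooth_vf_tangent[OF A x] and BC = smooth_lie_bracket[OF B C]
    have "nabla x (A x) (\<lambda>y. nabla y (B y) C) - nabla x (A x) (\<lambda>y. nabla y (C y) B)
        = nabla x (A x) (\<lambda>y. nabla y (B y) C - nabla y (C y) B)"
      by (rule nabla_diff[OF x At nabla_smooth[OF B C] nabla_smooth[OF C B], symmetric])
    also have "\<dots> = nabla x (A x) (lie_bracket M B C)"
      by (rule nabla_local[OF x At BC, symmetric]) (rule lie_bracket_torsion_free[OF B C])
    also have "\<dots> = lie_bracket M A (lie_bracket M B C) x + nabla x (lie_bracket M B C x) A"
      using lie_bracket_torsion_free[OF A BC x] by simp
    finally show ?thesis .
  qed
  have "curvature M nabla X Y Z x + curvature M nabla Y Z X x + curvature M nabla Z X Y x =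
    (nabla x (X x) (\<lambda>y. nabla y (Y y) Z) - nabla x (X x) (\<lambda>y. nabla y (Z y) Y)
       - nabla x (lie_bracket M Y Z x) X)
    + (nabla x (Y x) (\<lambda>y. nabla y (Z y) X) - nabla x (Y x) (\<lambda>y. nabla y (X y) Z)
       - nabla x (lie_bracket M Z X x) Y)
    + (nabla x (Z x) (\<lambda>y. nabla y (X y) Y) - nabla x (Z x) (\<lambda>y. nabla y (Y y) X)
       - nabla x (lie_bracket M X Y x) Z)"
    unfolding curvature_def by (simp add: algebra_simps)
  also have "\<dots> = lie_bracket M X (lie_bracket M Y Z) x + lie_bracket M Y (lie_bracket M Z X) x
      + lie_bracket M Z (lie_bracket M X Y) x"
    by (simp add: pair X Y Z)
  also have "\<dots> = 0" by (rule lie_bracket_jacobi[OF X Y Z x])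
  finally show ?thesis .
qed

section \<open>The curvature is a tensor in its first slot\<close>

lemma curvature_local:
  assumes X: "smooth_vf M V X" and Y: "smooth_vf M V Y" and Z: "smooth_vf M V Z" and x: "x \<in> V"
    and eq: "\<And>y. y \<in> V \<Longrightarrow> X y = X' y"
  shows "curvature M nabla X Y Z x = curvature M nabla X' Y Z x"
proof -
  note Yt = smooth_vf_tangent[OF Y x]
  have X': "smooth_vf M V X'" by (rule smooth_vf_cong[OF X eq])
  have "nabla x (Y x) (\<lambda>y. nabla y (X y) Z) = nabla x (Y x) (\<lambda>y. nabla y (X' y) Z)"
    by (rule nabla_local[OF x Yt nabla_smooth[OF X Z]]) (simp add: eq)
  moreover have "lie_bracket M X Y x = lie_bracket M X' Y x"
    using nabla_local[OF x Yt X eq] eq[OF x]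
    by (simp add: lie_bracket_torsion_free[OF X Y x] lie_bracket_torsion_free[OF X' Y x])
  ultimately show ?thesis by (simp add: curvature_def eq[OF x])
qed

lemma curvature_add_left:
  assumes X: "smooth_vf M V X" and X': "smooth_vf M V X'" and Y: "smooth_vf M V Y"
    and Z: "smooth_vf M V Z" and x: "x \<in> V"
  shows "curvature M nabla (\<lambda>y. X y + X' y) Y Z x = curvature M nabla X Y Z x + curvature M nabla X' Y Z x"
proof -
  note tan = smooth_vf_tangent[OF _ x]
  note XX = smooth_vf_add[OF X X'] and XZ = nabla_smooth[OF X Z] nabla_smooth[OF X' Z]
  have "nabla x (Y x) (\<lambda>y. nabla y (X y + X' y) Z)
      = nabla x (Y x) (\<lambda>y. nabla y (X y) Z + nabla y (X' y) Z)"
    by (rule nabla_local[OF x tan[OF Y] nabla_smooth[OF XX Z]])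
      (rule nabla_dir_add[OF _ _ Z]; simp add: smooth_vf_tangent[OF X] smooth_vf_tangent[OF X'])
  also have "\<dots> = nabla x (Y x) (\<lambda>y. nabla y (X y) Z) + nabla x (Y x) (\<lambda>y. nabla y (X' y) Z)"
    by (rule nabla_add[OF x tan[OF Y] XZ])
  finally have 1: "nabla x (Y x) (\<lambda>y. nabla y (X y + X' y) Z)
    = nabla x (Y x) (\<lambda>y. nabla y (X y) Z) + nabla x (Y x) (\<lambda>y. nabla y (X' y) Z)" .
  have "lie_bracket M (\<lambda>y. X y + X' y) Y x = lie_bracket M X Y x + lie_bracket M X' Y x"
    using nabla_dir_add[OF x tan[OF X] Y tan[OF X']] nabla_add[OF x tan[OF Y] X X']
    by (simp add: lie_bracket_torsion_free[OF _ Y x] X X' XX)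
  then have 2: "nabla x (lie_bracket M (\<lambda>y. X y + X' y) Y x) Z
      = nabla x (lie_bracket M X Y x) Z + nabla x (lie_bracket M X' Y x) Z"
    using nabla_dir_add[OF x tan[OF smooth_lie_bracket[OF X Y]] Z tan[OF smooth_lie_bracket[OF X' Y]]]
    by simp
  have 3: "nabla x (X x + X' x) (\<lambda>y. nabla y (Y y) Z)
      = nabla x (X x) (\<lambda>y. nabla y (Y y) Z) + nabla x (X' x) (\<lambda>y. nabla y (Y y) Z)"
    by (rule nabla_dir_add[OF x tan[OF X] nabla_smooth[OF Y Z] tan[OF X']])
  show ?thesis unfolding curvature_def 1 2 3 by simp
qed

text \<open>The derivative of \<open>f\<close> produced by \<open>\<nabla>\<^sub>Y(f\<nabla>\<^sub>XZ)\<close> cancels against the one in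
  \<open>[fX,Y] = f[X,Y] - (Yf)X\<close>.\<close>

lemma curvature_scale_left:
  assumes f: "smooth_fun M V f" and X: "smooth_vf M V X" and Y: "smooth_vf M V Y"
    and Z: "smooth_vf M V Z" and x: "x \<in> V"
  shows "curvature M nabla (\<lambda>y. f y *\<^sub>R X y) Y Z x = f x *\<^sub>R curvature M nabla X Y Z x"
proof -
  note tan = smooth_vf_tangent[OF _ x]
  note fX = smooth_vf_scale[OF f X] and XZ = nabla_smooth[OF X Z]
  have "nabla x (Y x) (\<lambda>y. nabla y (f y *\<^sub>R X y) Z) = nabla x (Y x) (\<lambda>y. f y *\<^sub>R nabla y (X y) Z)"
    by (rule nabla_local[OF x tan[OF Y] nabla_smooth[OF fX Z]])
      (rule nabla_dir_scale[OF _ _ Z]; simp add: smooth_vf_tangent[OF X])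
  also have "\<dots> = tapp (Y x) f *\<^sub>R nabla x (X x) Z + f x *\<^sub>R nabla x (Y x) (\<lambda>y. nabla y (X y) Z)"
    by (rule nabla_leibniz[OF x tan[OF Y] XZ f])
  finally have 1: "nabla x (Y x) (\<lambda>y. nabla y (f y *\<^sub>R X y) Z) = \<dots>" .
  have "lie_bracket M (\<lambda>y. f y *\<^sub>R X y) Y x = f x *\<^sub>R lie_bracket M X Y x - tapp (Y x) f *\<^sub>R X x"
    using nabla_dir_scale[OF x tan[OF X] Y] nabla_leibniz[OF x tan[OF Y] X f]
    by (simp add: lie_bracket_torsion_free[OF _ Y x] X fX algebra_simps)
  then have 2: "nabla x (lie_bracket M (\<lambda>y. f y *\<^sub>R X y) Y x) Z
      = f x *\<^sub>R nabla x (lie_bracket M X Y x) Z - tapp (Y x) f *\<^sub>R nabla x (X x) Z"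
    using tan[OF smooth_lie_bracket[OF X Y]] tan[OF X]
    by (simp add: nabla_dir_diff[OF x _ Z] nabla_dir_scale[OF x _ Z])
  have 3: "nabla x (f x *\<^sub>R X x) (\<lambda>y. nabla y (Y y) Z) = f x *\<^sub>R nabla x (X x) (\<lambda>y. nabla y (Y y) Z)"
    by (rule nabla_dir_scale[OF x tan[OF X] nabla_smooth[OF Y Z]])
  show ?thesis unfolding curvature_def 1 2 3 by (simp add: algebra_simps)
qed

text \<open>Linearity over functions in the first slot needs an expansion of the field \<open>X\<close> on all of \<open>V\<close>;
  its result depends only on the coefficients at \<open>x\<close>.\<close>

lemma curvature_frame_expansion:
  assumes F: "orthonormal_frame M g (tangent_space M) k V F"
    and X: "smooth_vf M V X" and Y: "smooth_vf M V Y" and Z: "smooth_vf M V Z" and x: "x \<in> V"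
  shows "curvature M nabla X Y Z x = (\<Sum>i=1..k. g x (X x) (F i x) *\<^sub>R curvature M nabla (F i) Y Z x)"
proof -
  note Fs = frame_smooth[OF F] and op = frame_openin[OF F]
  have sX: "smooth_vf M V (\<lambda>y. g y (X y) (F i y) *\<^sub>R F i y)" if "i \<in> {1..k}" for i
    by (intro smooth_vf_scale smooth_metric X Fs that)
  have zero: "curvature M nabla (\<lambda>_. 0) Y Z x = 0"
    using curvature_scale_left[OF smooth_fun_const[OF op, of 0] X Y Z x] by simp
  have "curvature M nabla X Y Z x
      = curvature M nabla (\<lambda>y. \<Sum>i=1..k. g y (X y) (F i y) *\<^sub>R F i y) Y Z x"
    by (rule curvature_local[OF X Y Z x], rule frame_expansion[OF F _ smooth_vf_tangent[OF X]])
  also have "\<dots> = (\<Sum>i\<in>I. g x (X x) (F i x) *\<^sub>R curvature M nabla (F i) Y Z x)"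
    if "I = {1..k}" for I
  proof -
    have "curvature M nabla (\<lambda>y. \<Sum>i\<in>J. g y (X y) (F i y) *\<^sub>R F i y) Y Z x
        = (\<Sum>i\<in>J. g x (X x) (F i x) *\<^sub>R curvature M nabla (F i) Y Z x)"
      if "finite J" "J \<subseteq> {1..k}" for J
      using that
    proof (induction J)
      case empty
      then show ?case by (simp add: zero)
    next
      case (insert j J)
      then have j: "j \<in> {1..k}" by simp
      have "smooth_vf M V (\<lambda>y. \<Sum>i\<in>J. g y (X y) (F i y) *\<^sub>R F i y)"
        using insert.prems by (intro smooth_vf_sum op sX) auto
      from curvature_add_left[OF sX[OF j] this Y Z x] insert
      show ?case
        using curvature_scale_left[OF smooth_metric[OF X Fs[OF j]] Fs[OF j] Y Z x] by simp
    qed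
    then show ?thesis using that by simp
  qed
  finally show ?thesis by simp
qed

text \<open>This allows a field that lies in a distribution at a single point to be replaced by one that
  lies in it everywhere.\<close>

lemma curvature_pointwise:
  assumes F: "orthonormal_frame M g (tangent_space M) k V F"
    and X: "smooth_vf M V X" and X': "smooth_vf M V X'" and Y: "smooth_vf M V Y"
    and Z: "smooth_vf M V Z" and x: "x \<in> V" and eq: "X x = X' x"
  shows "curvature M nabla X Y Z x = curvature M nabla X' Y Z x"
  unfolding curvature_frame_expansion[OF F X Y Z x] curvature_frame_expansion[OF F X' Y Z x] eq ..

end

section \<open>Exterior derivative and Ricci curvature in a frame\<close>

context levi_civita_mfd
begin

text \<open>With \<open>\<theta> = g(\<theta>\<^sup>\<sharp>, \<cdot>)\<close>, metric compatibility gives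
  \<open>X(\<theta>(U)) = g(\<nabla>\<^sub>X\<theta>\<^sup>\<sharp>, U) + \<theta>(\<nabla>\<^sub>XU)\<close>, and \<open>\<theta>(\<nabla>\<^sub>XU) - \<theta>(\<nabla>\<^sub>UX)\<close> cancels against \<open>\<theta>([X,U])\<close>.\<close>

lemma ext_deriv_sharp:
  assumes F: "orthonormal_frame M g (tangent_space M) k V F" and th: "one_form M \<theta>"
    and X: "smooth_vf M V X" and U: "smooth_vf M V U" and x: "x \<in> V"
  shows "ext_deriv M \<theta> X U x = g x (nabla x (X x) (sharp M g \<theta>)) (U x)
    - g x (nabla x (U x) (sharp M g \<theta>)) (X x)"
proof -
  note xt = smooth_vf_topspace[OF X x]
  note tan = smooth_vf_tangent[OF _ x]
  note S = sharp_props(1)[OF F th] and dual = sharp_props(2)[OF F th]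
  have deriv: "tapp (A x) (\<lambda>y. \<theta> y (B y))
      = g x (nabla x (A x) (sharp M g \<theta>)) (B x) + \<theta> x (nabla x (A x) B)"
    if A: "smooth_vf M V A" and B: "smooth_vf M V B" for A B
  proof -
    have "tapp (A x) (\<lambda>y. \<theta> y (B y)) = tapp (A x) (\<lambda>y. g y (sharp M g \<theta> y) (B y))"
      by (rule tapp_local[OF tan[OF A] smooth_metric[OF S B] x, symmetric])
        (simp add: dual smooth_vf_tangent[OF B])
    then show ?thesis
      using metric_compatible[OF A S B x] dual[OF x nabla_tangent[OF x tan[OF A] B]] by simp
  qed
  have t: "nabla x (X x) U \<in> tangent_space M x" "nabla x (U x) X \<in> tangent_space M x"
    by (intro nabla_tangent[OF x] tan X U)+
  have "\<theta> x (lie_bracket M X U x) = \<theta> x (nabla x (X x) U) - \<theta> x (nabla x (U x) X)"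
    using t dual[OF x t(1)] dual[OF x t(2)] dual[OF x tan[OF smooth_lie_bracket[OF X U]]] tan[OF S]
    by (simp add: lie_bracket_torsion_free[OF X U x] metric_simps[OF xt])
  then show ?thesis
    unfolding ext_deriv_def deriv[OF X U] deriv[OF U X] by simp
qed

text \<open>The definition takes the trace in an arbitrarily chosen frame \<open>E\<close>. Expanding \<open>E\<^sub>i\<close> in \<open>F\<^sub>j\<close> in the
  curvature slot and then \<open>F\<^sub>j\<close> in \<open>E\<^sub>i\<close> moves it to \<open>F\<close>.\<close>

lemma ricci_frame:
  fixes F :: "nat \<Rightarrow> 'a \<Rightarrow> 'a tvec"
  assumes F: "orthonormal_frame M g (tangent_space M) DIM('e) V F"
    and Y: "smooth_vf M V Y" and Z: "smooth_vf M V Z" and x: "x \<in> V"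
  shows "ricci M g nabla Y Z x = (\<Sum>i=1..DIM('e). g x (curvature M nabla (F i) Y Z x) (F i x))"
proof -
  define E where "E = onframe_at M g x"
  have "\<exists>E V. x \<in> V \<and> orthonormal_frame M g (tangent_space M) DIM('e) V E"
    using F x by blast
  then have "\<exists>V. x \<in> V \<and> orthonormal_frame M g (tangent_space M) DIM('e) V E"
    unfolding E_def onframe_at_def by (rule someI_ex)
  then obtain V' where V': "x \<in> V'" "orthonormal_frame M g (tangent_space M) DIM('e) V' E" by blast
  define W where "W = V \<inter> V'"
  have W: "openin (mtop M) W" "x \<in> W" "W \<subseteq> V" "W \<subseteq> V'"
    using frame_openin[OF F] frame_openin[OF V'(2)] x V'(1) by (auto simp: W_def)
  note FW = frame_subset[OF F W(1,3)] and EW = frame_subset[OF V'(2) W(1,4)]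
  note YW = smooth_vf_subset[OF Y W(1,3)] and ZW = smooth_vf_subset[OF Z W(1,3)]
  note Fs = frame_smooth[OF FW] and Es = frame_smooth[OF EW]
  note xt = frame_topspace[OF F x]
  define K where "K j = curvature M nabla (F j) Y Z x" for j
  have Kt: "K j \<in> tangent_space M x" if "j \<in> {1..DIM('e)}" for j
    unfolding K_def by (rule curvature_tangent[OF Fs[OF that] YW ZW W(2)])
  have Et: "E i x \<in> tangent_space M x" and Ft: "F i x \<in> tangent_space M x"
    if "i \<in> {1..DIM('e)}" for i
    using smooth_vf_tangent[OF Es[OF that] W(2)] smooth_vf_tangent[OF Fs[OF that] W(2)] .
  have "ricci M g nabla Y Z x = (\<Sum>i=1..DIM('e). g x (curvature M nabla (E i) Y Z x) (E i x))"
    by (simp add: ricci_def E_def Let_def)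
  also have "\<dots> = (\<Sum>i=1..DIM('e). \<Sum>j=1..DIM('e). g x (F j x) (E i x) * g x (K j) (E i x))"
  proof (rule sum.cong[OF refl])
    fix i assume i: "i \<in> {1..DIM('e)}"
    have "g x (curvature M nabla (E i) Y Z x) (E i x)
        = g x (\<Sum>j=1..DIM('e). g x (E i x) (F j x) *\<^sub>R K j) (E i x)"
      by (simp only: curvature_frame_expansion[OF FW Es[OF i] YW ZW W(2)] K_def)
    also have "\<dots> = (\<Sum>j=1..DIM('e). g x (F j x) (E i x) * g x (K j) (E i x))"
      using Kt Et Ft Et[OF i]
      by (subst metric_sum_left[OF xt])
        (auto simp: metric_simps[OF xt] metric_sym[OF xt Et[OF i]] intro!: sum.cong)
    finally show "g x (curvature M nabla (E i) Y Z x) (E i x) = \<dots>" .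
  qed
  also have "\<dots> = (\<Sum>j=1..DIM('e). \<Sum>i=1..DIM('e). g x (F j x) (E i x) * g x (K j) (E i x))"
    by (rule sum.swap)
  also have "\<dots> = (\<Sum>j=1..DIM('e). g x (K j) (F j x))"
  proof (rule sum.cong[OF refl])
    fix j assume j: "j \<in> {1..DIM('e)}"
    have "g x (K j) (F j x) = g x (K j) (\<Sum>i=1..DIM('e). g x (F j x) (E i x) *\<^sub>R E i x)"
      using frame_expansion[OF EW W(2) Ft[OF j]] by simp
    also have "\<dots> = (\<Sum>i=1..DIM('e). g x (F j x) (E i x) * g x (K j) (E i x))"
      using Et Kt[OF j]
      by (subst metric_sum_right[OF xt]) (auto simp: metric_simps[OF xt] intro!: sum.cong)
    finally show "(\<Sum>i=1..DIM('e). g x (F j x) (E i x) * g x (K j) (E i x)) = g x (K j) (F j x)"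
      by simp
  qed
  finally show ?thesis by (simp add: K_def)
qed

text \<open>\<open>X\<close> lies in \<open>T\<close> at \<open>x\<close> only, so near \<open>x\<close> it need not be a combination of the \<open>e\<^sub>a\<close>; the expansion
  passes through a frame of the whole tangent bundle.\<close>

lemma curvature_subframe_expansion:
  assumes F: "orthonormal_frame M g (tangent_space M) n V F"
    and e: "orthonormal_frame M g T k V e" and X: "smooth_vf M V X" and XT: "X x \<in> T x"
    and Y: "smooth_vf M V Y" and Z: "smooth_vf M V Z" and x: "x \<in> V"
  shows "curvature M nabla X Y Z x = (\<Sum>a=1..k. g x (X x) (e a x) *\<^sub>R curvature M nabla (e a) Y Z x)"
proof -
  note xt = frame_topspace[OF F x]
  note es = frame_smooth[OF e]
  define c where "c a = g x (X x) (e a x)" for a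
  have et: "e a x \<in> tangent_space M x" if "a \<in> {1..k}" for a
    using smooth_vf_tangent[OF es[OF that] x] .
  have coeff: "(\<Sum>a=1..k. c a * g x (e a x) (F j x)) = g x (X x) (F j x)" if "j \<in> {1..n}" for j
  proof -
    have Ft: "F j x \<in> tangent_space M x" using frame_in[OF F x that] .
    have "g x (X x) (F j x) = g x (\<Sum>a=1..k. c a *\<^sub>R e a x) (F j x)"
      unfolding c_def using frame_expansion[OF e x XT] by simp
    also have "\<dots> = (\<Sum>a=1..k. c a * g x (e a x) (F j x))"
      using et Ft by (subst metric_sum_left[OF xt]) (auto simp: metric_simps[OF xt] intro!: sum.cong)
    finally show ?thesis by simp
  qed
  have "(\<Sum>a=1..k. c a *\<^sub>R curvature M nabla (e a) Y Z x)
      = (\<Sum>a=1..k. \<Sum>j=1..n. (c a * g x (e a x) (F j x)) *\<^sub>R curvature M nabla (F j) Y Z x)"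
    by (intro sum.cong refl, subst curvature_frame_expansion[OF F es Y Z x])
      (auto simp: scaleR_sum_right)
  also have "\<dots> = (\<Sum>j=1..n. \<Sum>a=1..k. (c a * g x (e a x) (F j x)) *\<^sub>R curvature M nabla (F j) Y Z x)"
    by (rule sum.swap)
  also have "\<dots> = (\<Sum>j=1..n. g x (X x) (F j x) *\<^sub>R curvature M nabla (F j) Y Z x)"
    by (intro sum.cong refl) (simp only: scaleR_sum_left[symmetric] coeff)
  also have "\<dots> = curvature M nabla X Y Z x"
    by (rule curvature_frame_expansion[OF F X Y Z x, symmetric])
  finally show ?thesis by (simp add: c_def)
qed

lemma ricci_subframe_expansion:
  fixes F :: "nat \<Rightarrow> 'a \<Rightarrow> 'a tvec"
  assumes F: "orthonormal_frame M g (tangent_space M) DIM('e) V F"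
    and e: "orthonormal_frame M g T k V e" and X: "smooth_vf M V X" and XT: "X x \<in> T x"
    and Z: "smooth_vf M V Z" and x: "x \<in> V"
  shows "ricci M g nabla X Z x = (\<Sum>a=1..k. g x (X x) (e a x) * ricci M g nabla (e a) Z x)"
proof -
  note xt = frame_topspace[OF F x]
  note es = frame_smooth[OF e] and Fs = frame_smooth[OF F]
  note Ft = smooth_vf_tangent[OF Fs x]
  have swap: "ricci M g nabla Y Z x = (\<Sum>i=1..DIM('e). - g x (curvature M nabla Y (F i) Z x) (F i x))"
    if Y: "smooth_vf M V Y" for Y
    unfolding ricci_frame[OF F Y Z x] using Ft curvature_tangent[OF Y Fs Z x]
    by (intro sum.cong refl) (simp add: curvature_swap[OF Fs Y Z x] metric_minus_left[OF xt])
  have "- g x (curvature M nabla X (F i) Z x) (F i x)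
      = (\<Sum>a=1..k. g x (X x) (e a x) * - g x (curvature M nabla (e a) (F i) Z x) (F i x))"
    if i: "i \<in> {1..DIM('e)}" for i
    unfolding curvature_subframe_expansion[OF F e X XT Fs[OF i] Z x]
    using Ft[OF i] curvature_tangent[OF es Fs[OF i] Z x]
    by (subst metric_sum_left[OF xt])
      (auto simp: metric_simps[OF xt] sum_negf[symmetric] intro!: sum.cong)
  then have "ricci M g nabla X Z x = (\<Sum>i=1..DIM('e). \<Sum>a=1..k.
      g x (X x) (e a x) * - g x (curvature M nabla (e a) (F i) Z x) (F i x))"
    unfolding swap[OF X] by (intro sum.cong) auto
  also have "\<dots> = (\<Sum>a=1..k. \<Sum>i=1..DIM('e).
      g x (X x) (e a x) * - g x (curvature M nabla (e a) (F i) Z x) (F i x))"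
    by (rule sum.swap)
  also have "\<dots> = (\<Sum>a=1..k. g x (X x) (e a x) * ricci M g nabla (e a) Z x)"
    by (intro sum.cong refl) (simp only: swap[OF es] sum_distrib_left)
  finally show ?thesis .
qed

end

section \<open>Distributions preserved by a Weyl connection\<close>

text \<open>The frame \<open>F\<close> of the tangent bundle makes \<open>\<theta>\<^sup>\<sharp>\<close> and the tensor property of the curvature
  available on \<open>V\<close>.\<close>

locale preserved_distribution = levi_civita_mfd M g nabla
  for M :: "('a, 'e::euclidean_space) manifold" and g nabla +
  fixes \<theta> D T V F k e n
  assumes weyl: "weyl_connection M g nabla \<theta> D"
    and preserves: "preserves M D T"
    and full_frame: "orthonormal_frame M g (tangent_space M) n V F"
    and frame: "orthonormal_frame M g T k V e"
begin

abbreviation S where "S \<equiv> sharp M g \<theta>"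

text \<open>The tensor \<open>\<nabla>\<theta> - \<theta> \<otimes> \<theta>\<close>, with \<open>(\<nabla>\<^sub>v\<theta>)(w)\<close> written as \<open>g(\<nabla>\<^sub>v\<theta>\<^sup>\<sharp>, w)\<close>. Its skew part is that of \<open>\<nabla>\<theta>\<close>.\<close>

definition lee_hessian where "lee_hessian x v w = g x (nabla x v S) w - \<theta> x v * \<theta> x w"

lemma one_form: "one_form M \<theta>"
  using weyl by (simp add: weyl_connection_def)

lemmas S_smooth = sharp_props(1)[OF full_frame one_form]
lemmas S_dual = sharp_props(2)[OF full_frame one_form]

lemma weyl_formula:
  assumes "smooth_vf M V Y" "y \<in> V" "v \<in> tangent_space M y"
  shows "D y v Y = nabla y v Y + \<theta> y (Y y) *\<^sub>R v + \<theta> y v *\<^sub>R Y y - g y v (Y y) *\<^sub>R S y"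
  using weyl smooth_vf_topspace[OF assms(1,2)] smooth_vf_nearI[OF assms(1,2)] assms(3)
  unfolding weyl_connection_def by simp

lemma D_in:
  assumes "smooth_vf M V Y" "\<And>y. y \<in> V \<Longrightarrow> Y y \<in> T y" "y \<in> V" "v \<in> tangent_space M y"
  shows "D y v Y \<in> T y"
  using preserves assms unfolding preserves_def by blast

text \<open>\<open>g(D\<^sub>vY, u) = 0\<close>, and of the three correction terms in \<open>D\<^sub>vY - \<nabla>\<^sub>vY\<close> two are multiples of \<open>v\<close> and
  \<open>Y\<close>, hence orthogonal to \<open>u\<close>.\<close>

lemma second_fundamental_form:
  assumes Y: "smooth_vf M V Y" and YT: "\<And>y. y \<in> V \<Longrightarrow> Y y \<in> T y" and x: "x \<in> V"
    and v: "v \<in> T x" and u: "u \<in> tangent_space M x" and orth: "\<And>w. w \<in> T x \<Longrightarrow> g x w u = 0"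
  shows "g x (nabla x v Y) u = g x v (Y x) * \<theta> x u"
proof -
  note xt = smooth_vf_topspace[OF Y x]
  have vt: "v \<in> tangent_space M x" using frame_tangent[OF frame x] v by blast
  note t = vt smooth_vf_tangent[OF Y x] smooth_vf_tangent[OF S_smooth x] nabla_tangent[OF x vt Y] u
  have "g x (D x v Y) u = 0" by (rule orth[OF D_in[OF Y YT x vt]])
  then show ?thesis
    unfolding weyl_formula[OF Y x vt]
    using t orth[OF v] orth[OF YT[OF x]] S_dual[OF x u] by (simp add: metric_simps[OF xt])
qed

text \<open>Up to multiples of \<open>Y\<close> and \<open>Z\<close>, this difference is \<open>D\<^sub>YZ\<close>.\<close>

lemma nabla_residue_in:
  assumes Y: "smooth_vf M V Y" and YT: "Y y \<in> T y"
    and Z: "smooth_vf M V Z" and ZT: "\<And>y. y \<in> V \<Longrightarrow> Z y \<in> T y" and y: "y \<in> V"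
  shows "nabla y (Y y) Z - g y (Y y) (Z y) *\<^sub>R S y \<in> T y"
proof -
  note sub = frame_subspace[OF frame y] and Yt = smooth_vf_tangent[OF Y y]
  have "nabla y (Y y) Z - g y (Y y) (Z y) *\<^sub>R S y
      = D y (Y y) Z - \<theta> y (Z y) *\<^sub>R Y y - \<theta> y (Y y) *\<^sub>R Z y"
    unfolding weyl_formula[OF Z y Yt] by simp
  also have "\<dots> \<in> T y"
    by (intro subspace_diff[OF sub] subspace_scale[OF sub] D_in[OF Z ZT y Yt] YT ZT[OF y])
  finally show ?thesis .
qed

text \<open>Write \<open>\<nabla>\<^sub>BZ = P + g(B,Z) \<theta>\<^sup>\<sharp>\<close> with \<open>P\<close> in \<open>T\<close> and differentiate along \<open>A\<close>. By the second
  fundamental form, \<open>g(\<nabla>\<^sub>AP, u) = g(A,P) \<theta>(u)\<close>, where \<open>g(A,P) = g(A,\<nabla>\<^sub>BZ) - g(B,Z) \<theta>(A)\<close> provides the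
  product in \<open>h\<close>; the other summand gives \<open>A(g(B,Z)) \<theta>(u) + g(B,Z) g(\<nabla>\<^sub>A\<theta>\<^sup>\<sharp>, u)\<close>. Skew-symmetrized in
  \<open>A, B\<close>, the remaining terms \<open>g(A,\<nabla>\<^sub>BZ) + A(g(B,Z))\<close> become \<open>g([A,B],Z)\<close>, and \<open>\<nabla>\<^bsub>[A,B]\<^esub>Z\<close> removes them.\<close>

lemma curvature_normal_component:
  assumes X: "smooth_vf M V X" and XT: "\<And>y. y \<in> V \<Longrightarrow> X y \<in> T y"
    and Y: "smooth_vf M V Y" and YT: "\<And>y. y \<in> V \<Longrightarrow> Y y \<in> T y"
    and Z: "smooth_vf M V Z" and ZT: "\<And>y. y \<in> V \<Longrightarrow> Z y \<in> T y" and x: "x \<in> V"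
    and u: "u \<in> tangent_space M x" and orth: "\<And>w. w \<in> T x \<Longrightarrow> g x w u = 0"
  shows "g x (curvature M nabla X Y Z x) u
    = g x (Y x) (Z x) * lee_hessian x (X x) u - g x (X x) (Z x) * lee_hessian x (Y x) u"
proof -
  note xt = smooth_vf_topspace[OF X x]
  note tan = smooth_vf_tangent[OF _ x]
  note St = tan[OF S_smooth]
  have second: "g x (nabla x (A x) (\<lambda>y. nabla y (B y) Z)) u =
      (g x (A x) (nabla x (B x) Z) + g x (nabla x (A x) B) (Z x) + g x (B x) (nabla x (A x) Z)) * \<theta> x u
      + g x (B x) (Z x) * lee_hessian x (A x) u"
    if A: "smooth_vf M V A" and AT: "\<And>y. y \<in> V \<Longrightarrow> A y \<in> T y"
      and B: "smooth_vf M V B" and BT: "\<And>y. y \<in> V \<Longrightarrow> B y \<in> T y" for A B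
  proof -
    define f where "f y = g y (B y) (Z y)" for y
    define P where "P y = nabla y (B y) Z - f y *\<^sub>R S y" for y
    have f: "smooth_fun M V f" unfolding f_def[abs_def] by (rule smooth_metric[OF B Z])
    have fS: "smooth_vf M V (\<lambda>y. f y *\<^sub>R S y)" by (rule smooth_vf_scale[OF f S_smooth])
    have P: "smooth_vf M V P" unfolding P_def[abs_def]
      by (rule smooth_vf_diff[OF nabla_smooth[OF B Z] fS])
    have PT: "P y \<in> T y" if "y \<in> V" for y
      unfolding P_def f_def by (rule nabla_residue_in[OF B BT[OF that] Z ZT that])
    note At = tan[OF A]
    have t: "nabla x (A x) P \<in> tangent_space M x" "nabla x (A x) S \<in> tangent_space M x"
      "nabla x (B x) Z \<in> tangent_space M x"
      by (intro nabla_tangent[OF x] tan A B P S_smooth Z)+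
    have "nabla x (A x) (\<lambda>y. nabla y (B y) Z) = nabla x (A x) (\<lambda>y. P y + f y *\<^sub>R S y)"
      by (simp add: P_def)
    also have "\<dots> = nabla x (A x) P + (tapp (A x) f *\<^sub>R S x + f x *\<^sub>R nabla x (A x) S)"
      by (simp only: nabla_add[OF x At P fS] nabla_leibniz[OF x At S_smooth f])
    finally have "g x (nabla x (A x) (\<lambda>y. nabla y (B y) Z)) u
        = g x (nabla x (A x) P) u + tapp (A x) f * \<theta> x u + f x * g x (nabla x (A x) S) u"
      using t St u S_dual[OF x u] by (simp add: metric_simps[OF xt])
    moreover have "g x (nabla x (A x) P) u = g x (A x) (P x) * \<theta> x u"
      by (rule second_fundamental_form[OF P PT x AT[OF x] u orth])
    moreover have "g x (A x) (P x) = g x (A x) (nabla x (B x) Z) - f x * \<theta> x (A x)"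
      unfolding P_def using t St At S_dual[OF x At]
      by (simp add: metric_simps[OF xt] metric_sym[OF xt At St])
    moreover have "tapp (A x) f = g x (nabla x (A x) B) (Z x) + g x (B x) (nabla x (A x) Z)"
      unfolding f_def[abs_def] by (rule metric_compatible[OF A B Z x])
    ultimately show ?thesis
      unfolding lee_hessian_def by (simp add: f_def algebra_simps)
  qed
  note L = smooth_lie_bracket[OF X Y]
  have t: "nabla x (X x) Y \<in> tangent_space M x" "nabla x (Y x) X \<in> tangent_space M x"
    "nabla x (X x) (\<lambda>y. nabla y (Y y) Z) \<in> tangent_space M x"
    "nabla x (Y x) (\<lambda>y. nabla y (X y) Z) \<in> tangent_space M x"
    "nabla x (lie_bracket M X Y x) Z \<in> tangent_space M x"
    by (intro nabla_tangent[OF x] tan nabla_smooth X Y Z L)+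
  \<comment> \<open>\<open>T\<close> is integrable, since its second fundamental form is symmetric\<close>
  have LT: "lie_bracket M X Y x \<in> T x"
  proof -
    have "lie_bracket M X Y x = (nabla x (X x) Y - g x (X x) (Y x) *\<^sub>R S x)
        - (nabla x (Y x) X - g x (Y x) (X x) *\<^sub>R S x)"
      using metric_sym[OF xt tan[OF X] tan[OF Y]] by (simp add: lie_bracket_torsion_free[OF X Y x])
    also have "\<dots> \<in> T x"
      by (intro subspace_diff[OF frame_subspace[OF frame x]] nabla_residue_in X Y XT YT x)
    finally show ?thesis .
  qed
  have third: "g x (nabla x (lie_bracket M X Y x) Z) u
      = (g x (nabla x (X x) Y) (Z x) - g x (nabla x (Y x) X) (Z x)) * \<theta> x u"
    using second_fundamental_form[OF Z ZT x LT u orth] t tan[OF Z]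
    by (simp add: lie_bracket_torsion_free[OF X Y x] metric_simps[OF xt])
  show ?thesis
    unfolding curvature_def using t u
    by (simp add: metric_simps[OF xt] second X XT Y YT third) (simp add: algebra_simps)
qed

text \<open>The \<open>k\<close> terms \<open>g(e\<^sub>a,e\<^sub>a) h(X,u)\<close> are diminished by \<open>\<Sum>\<^sub>a g(X,e\<^sub>a) h(e\<^sub>a,u) = h(X,u)\<close>.\<close>

lemma curvature_partial_trace:
  assumes X: "smooth_vf M V X" and XT: "X x \<in> T x" and x: "x \<in> V"
    and u: "u \<in> tangent_space M x" and orth: "\<And>w. w \<in> T x \<Longrightarrow> g x w u = 0"
  shows "(\<Sum>a=1..k. g x (curvature M nabla X (e a) (e a) x) u) = (real k - 1) * lee_hessian x (X x) u"
proof -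
  note xt = smooth_vf_topspace[OF X x]
  note es = frame_smooth[OF frame]
  note eT = frame_in[OF frame]
  note et = smooth_vf_tangent[OF es x]
  define c where "c a = g x (X x) (e a x)" for a
  \<comment> \<open>\<open>X\<close> lies in \<open>T\<close> at \<open>x\<close> only; a combination with constant coefficients lies in it everywhere\<close>
  define X' where "X' y = (\<Sum>a=1..k. c a *\<^sub>R e a y)" for y
  have X': "smooth_vf M V X'" unfolding X'_def[abs_def]
    by (intro smooth_vf_sum smooth_vf_scale_const es frame_openin[OF frame])
  have X'T: "X' y \<in> T y" if "y \<in> V" for y
    unfolding X'_def using that
    by (intro subspace_sum subspace_scale frame_subspace[OF frame] eT)
  have X'x: "X' x = X x"
    unfolding X'_def c_def by (rule frame_expansion[OF frame x XT, symmetric])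
  have hX: "(\<Sum>a=1..k. c a * lee_hessian x (e a x) u) = lee_hessian x (X x) u"
  proof -
    have "g x (nabla x (X x) S) u = g x (\<Sum>a=1..k. c a *\<^sub>R nabla x (e a x) S) u"
      unfolding X'x[symmetric] X'_def using et
      by (subst nabla_dir_sum[OF x S_smooth])
        (auto simp: nabla_dir_scale[OF x _ S_smooth] intro!: arg_cong[where f = "\<lambda>v. g x v u"] sum.cong)
    also have "\<dots> = (\<Sum>a=1..k. c a * g x (nabla x (e a x) S) u)"
      using nabla_tangent[OF x et S_smooth] u
      by (subst metric_sum_left[OF xt]) (auto simp: metric_simps[OF xt] intro!: sum.cong)
    finally have 1: "g x (nabla x (X x) S) u = \<dots>" .
    note St = smooth_vf_tangent[OF S_smooth x]
    have "\<theta> x (X x) = g x (S x) (\<Sum>a=1..k. c a *\<^sub>R e a x)"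
      using S_dual[OF x smooth_vf_tangent[OF X x]] X'x by (simp add: X'_def)
    also have "\<dots> = (\<Sum>a=1..k. c a * \<theta> x (e a x))"
      using et St S_dual[OF x et]
      by (subst metric_sum_right[OF xt]) (auto simp: metric_simps[OF xt] intro!: sum.cong)
    finally show ?thesis
      unfolding lee_hessian_def 1 by (simp add: sum_subtractf sum_distrib_left algebra_simps)
  qed
  have "g x (curvature M nabla X (e a) (e a) x) u = lee_hessian x (X x) u - c a * lee_hessian x (e a x) u"
    if a: "a \<in> {1..k}" for a
  proof -
    have "curvature M nabla X (e a) (e a) x = curvature M nabla X' (e a) (e a) x"
      by (rule curvature_pointwise[OF full_frame X X' es[OF a] es[OF a] x X'x[symmetric]])
    then show ?thesis
      using curvature_normal_component[OF X' X'T es[OF a] eT[OF _ a] es[OF a] eT[OF _ a] x u orth]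
        frame_metric[OF frame x a a] by (simp add: X'x c_def)
  qed
  then have "(\<Sum>a=1..k. g x (curvature M nabla X (e a) (e a) x) u)
      = (\<Sum>a=1..k. lee_hessian x (X x) u - c a * lee_hessian x (e a x) u)" by (intro sum.cong) auto
  then show ?thesis using hX by (simp add: sum_subtractf algebra_simps)
qed

end

section \<open>The mixed part of the Weyl tensor\<close>

lemma (in riemannian) orthonormal_frame_append:
  assumes e: "orthonormal_frame M g T1 p V e" and f: "orthonormal_frame M g T2 q V f"
    and split: "\<And>y. y \<in> V \<Longrightarrow> tangent_space M y = {v + w |v w. v \<in> T1 y \<and> w \<in> T2 y}"
    and orth: "\<And>y v w. y \<in> V \<Longrightarrow> v \<in> T1 y \<Longrightarrow> w \<in> T2 y \<Longrightarrow> g y v w = 0"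
  shows "orthonormal_frame M g (tangent_space M) (p + q) V (\<lambda>i. if i \<le> p then e i else f (i - p))"
    (is "orthonormal_frame _ _ _ _ _ ?F")
  unfolding orthonormal_frame_def
proof (intro conjI ballI)
  show "openin (mtop M) V" by (rule frame_openin[OF e])
  have f': "i - p \<in> {1..q}" if "i \<in> {1..p+q}" "\<not> i \<le> p" for i using that by auto
  have e': "i \<in> {1..p}" if "i \<in> {1..p+q}" "i \<le> p" for i using that by auto
  show "smooth_vf M V (?F i)" if "i \<in> {1..p+q}" for i
    using frame_smooth[OF e e'[OF that]] frame_smooth[OF f f'[OF that]] by simp
  fix y assume y: "y \<in> V"
  note yt = frame_topspace[OF e y]
  have eq: "(\<lambda>i. ?F i y) ` {1..p+q} = (\<lambda>i. e i y) ` {1..p} \<union> (\<lambda>i. f i y) ` {1..q}"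
  proof (intro equalityI subsetI)
    fix v assume "v \<in> (\<lambda>i. ?F i y) ` {1..p+q}"
    then obtain i where i: "i \<in> {1..p+q}" "v = ?F i y" by blast
    show "v \<in> (\<lambda>i. e i y) ` {1..p} \<union> (\<lambda>i. f i y) ` {1..q}"
      using e'[OF i(1)] f'[OF i(1)] i(2) by (cases "i \<le> p") auto
  next
    fix v assume "v \<in> (\<lambda>i. e i y) ` {1..p} \<union> (\<lambda>i. f i y) ` {1..q}"
    then consider a where "a \<in> {1..p}" "v = e a y" | b where "b \<in> {1..q}" "v = f b y" by blast
    then show "v \<in> (\<lambda>i. ?F i y) ` {1..p+q}"
    proof cases
      case 1
      then show ?thesis by (intro image_eqI[of _ _ a]) auto
    next
      case 2
      then show ?thesis by (intro image_eqI[of _ _ "b + p"]) auto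
    qed
  qed
  show "tangent_space M y = span ((\<lambda>i. ?F i y) ` {1..p+q})"
    unfolding split[OF y] eq span_Un frame_span[OF e y] frame_span[OF f y] by blast
  show "g y (?F i y) (?F j y) = (if i = j then 1 else 0)"
    if "i \<in> {1..p+q}" "j \<in> {1..p+q}" for i j
  proof -
    have ef: "g y (e a y) (f b y) = 0" "g y (f b y) (e a y) = 0" if "a \<in> {1..p}" "b \<in> {1..q}" for a b
      using orth[OF y frame_in[OF e y that(1)] frame_in[OF f y that(2)]]
        metric_sym[OF yt, of "e a y" "f b y"] smooth_vf_tangent[OF frame_smooth[OF e that(1)] y]
        smooth_vf_tangent[OF frame_smooth[OF f that(2)] y] by simp_all
    show ?thesis
      using that e'[OF that(1)] e'[OF that(2)] f'[OF that(1)] f'[OF that(2)]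
        ef frame_metric[OF e y] frame_metric[OF f y]
      by (cases "i \<le> p"; cases "j \<le> p") auto
  qed
qed

theorem corollary2p14:
  fixes M :: "('a, 'e::euclidean_space) manifold"
    and g :: "'a \<Rightarrow> 'a tvec \<Rightarrow> 'a tvec \<Rightarrow> real"
    and nabla D :: "'a connection"
    and \<theta> :: "'a \<Rightarrow> 'a tvec \<Rightarrow> real"
    and T1 T2 :: "'a \<Rightarrow> 'a tvec set"
    and X U :: "'a \<Rightarrow> 'a tvec"
    and e :: "nat \<Rightarrow> 'a \<Rightarrow> 'a tvec"
    and n p q :: nat
  assumes "smooth_manifold M" and "n = DIM('e)"
    and "riemannian_metric M g" and "levi_civita M g nabla"
    and "conformal_product_structure M g nabla \<theta> D p T1 q T2"
    and "p \<ge> 2" and "q \<ge> 2" and "n = p + q"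
    and "orthonormal_frame M g T1 p V e"
    and "smooth_vf M V X" and "smooth_vf M V U"
    and "x \<in> V" and "X x \<in> T1 x" and "U x \<in> T2 x"
  shows "ext_deriv M \<theta> X U x =
    (real n - 2) / ((real p - 1) * (real q - 1)) * (\<Sum>a=1..p. weyl M g nabla X (e a) (e a) U x)"
proof -
  interpret levi_civita_mfd M g nabla
    by unfold_locales (fact assms)+
  note XT = \<open>X x \<in> T1 x\<close> and UT = \<open>U x \<in> T2 x\<close>
  have xt: "x \<in> topspace (mtop M)" by (rule smooth_vf_topspace[OF \<open>smooth_vf M V X\<close> \<open>x \<in> V\<close>])
  have dist: "distribution M q T2" and weyl: "weyl_connection M g nabla \<theta> D"
    and pres: "preserves M D T1" "preserves M D T2"
    and split: "\<And>y. y \<in> topspace (mtop M) \<Longrightarrow> tangent_space M y = {v + w |v w. v \<in> T1 y \<and> w \<in> T2 y}"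
    and orth: "\<And>y v w. y \<in> topspace (mtop M) \<Longrightarrow> v \<in> T1 y \<Longrightarrow> w \<in> T2 y \<Longrightarrow> g y v w = 0"
    using \<open>conformal_product_structure M g nabla \<theta> D p T1 q T2\<close>
    unfolding conformal_product_structure_def by (elim conjE; simp)+
  obtain V' f where V': "x \<in> V'" "orthonormal_frame M g T2 q V' f"
    by (rule distribution_orthonormal_frame[OF dist xt])
  define W where "W = V \<inter> V'"
  have Wo: "openin (mtop M) W" and x: "x \<in> W" and WV: "W \<subseteq> V" "W \<subseteq> V'"
    using V' \<open>x \<in> V\<close> frame_openin[OF V'(2)] frame_openin[OF assms(9)] by (auto simp: W_def)
  have Wt: "y \<in> topspace (mtop M)" if "y \<in> W" for y using openin_subset[OF Wo] that by blast
  note e = frame_subset[OF assms(9) Wo WV(1)] and f = frame_subset[OF V'(2) Wo WV(2)]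
  note X = smooth_vf_subset[OF \<open>smooth_vf M V X\<close> Wo WV(1)]
  note U = smooth_vf_subset[OF \<open>smooth_vf M V U\<close> Wo WV(1)]
  note tan = smooth_vf_tangent[OF _ x]
  define F where "F i = (if i \<le> p then e i else f (i - p))" for i
  have F: "orthonormal_frame M g (tangent_space M) (p + q) W F"
    unfolding F_def[abs_def] by (rule orthonormal_frame_append[OF e f split[OF Wt] orth[OF Wt]])
  have dim: "p + q = DIM('e)" using assms by simp
  interpret P: preserved_distribution M g nabla \<theta> D T1 W F p e "p + q"
    by unfold_locales (fact weyl pres F e)+
  interpret Q: preserved_distribution M g nabla \<theta> D T2 W F q f "p + q"
    by unfold_locales (fact weyl pres F f)+
  have es: "smooth_vf M W (e a)" if "a \<in> {1..p}" for a using frame_smooth[OF e that] .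
  have fs: "smooth_vf M W (f b)" if "b \<in> {1..q}" for b using frame_smooth[OF f that] .

  define A where "A = (\<Sum>a=1..p. g x (curvature M nabla X (e a) (e a) x) (U x))"
  define B where "B = (\<Sum>b=1..q. g x (curvature M nabla U (f b) (f b) x) (X x))"
  define Ric where "Ric = ricci M g nabla X U x"

  have T2_orth: "g x w (X x) = 0" if "w \<in> T2 x" for w
    using orth[OF xt XT that] metric_sym[OF xt tan[OF X]] frame_tangent[OF f x] that by auto
  have A: "A = (real p - 1) * P.lee_hessian x (X x) (U x)"
    unfolding A_def by (rule P.curvature_partial_trace[OF X XT x tan[OF U] orth[OF xt _ UT]])
  have B: "B = (real q - 1) * P.lee_hessian x (U x) (X x)"
    unfolding B_def using Q.curvature_partial_trace[OF U UT x tan[OF X] T2_orth]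
    by (simp add: P.lee_hessian_def Q.lee_hessian_def)
  have d\<theta>: "ext_deriv M \<theta> X U x = P.lee_hessian x (X x) (U x) - P.lee_hessian x (U x) (X x)"
    using ext_deriv_sharp[OF F P.one_form X U x] by (simp add: P.lee_hessian_def)

  have Ric: "Ric = A + B"
  proof -
    have "Ric = (\<Sum>i=1..p+q. g x (curvature M nabla (F i) X U x) (F i x))"
      unfolding Ric_def dim by (rule ricci_frame[OF F[unfolded dim] X U x])
    also have "\<dots> = (\<Sum>a=1..p. g x (curvature M nabla (e a) X U x) (e a x))
        + (\<Sum>b=1..q. g x (curvature M nabla (f b) X U x) (f b x))"
      using sum.ub_add_nat[of 1 p "\<lambda>i. g x (curvature M nabla (F i) X U x) (F i x)" q]
        sum.shift_bounds_cl_nat_ivl[of "\<lambda>i. g x (curvature M nabla (F i) X U x) (F i x)" 1 p q]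
      by (simp add: F_def add.commute[of p])
    also have "(\<Sum>a=1..p. g x (curvature M nabla (e a) X U x) (e a x)) = A"
      unfolding A_def
    proof (rule sum.cong[OF refl])
      fix a assume a: "a \<in> {1..p}"
      show "g x (curvature M nabla (e a) X U x) (e a x) = g x (curvature M nabla X (e a) (e a) x) (U x)"
        using curvature_swap[OF es[OF a] X U x] curvature_skew[OF X es[OF a] U es[OF a] x]
          metric_minus_left[OF xt curvature_tangent[OF X es[OF a] U x] tan[OF es[OF a]]] by simp
    qed
    also have "(\<Sum>b=1..q. g x (curvature M nabla (f b) X U x) (f b x)) = B"
      unfolding B_def
    proof (rule sum.cong[OF refl])
      fix b assume b: "b \<in> {1..q}"
      note fb = fs[OF b]
      note ct = curvature_tangent[OF fb X U x] curvature_tangent[OF X U fb x]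
        curvature_tangent[OF U fb X x]
      \<comment> \<open>the second term of the Bianchi sum has no \<open>f\<^sub>b\<close>-component because \<open>R(X,U)\<close> is skew\<close>
      have "g x (curvature M nabla (f b) X U x + curvature M nabla X U (f b) x
          + curvature M nabla U (f b) X x) (f b x) = 0"
        unfolding curvature_bianchi[OF fb X U x] by (rule metric_zero_left[OF xt tan[OF fb]])
      then show "g x (curvature M nabla (f b) X U x) (f b x)
          = g x (curvature M nabla U (f b) (f b) x) (X x)"
        using ct tan[OF fb] curvature_skew[OF X U fb fb x] curvature_skew[OF U fb X fb x]
        by (simp add: metric_simps[OF xt])
    qed
    finally show ?thesis .
  qed

  \<comment> \<open>\<open>U\<close> is orthogonal to \<open>X\<close> and \<open>e\<^sub>a\<close>, which leaves two of the four Ricci terms and no scalar curvature\<close>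
  have gXU: "g x (X x) (U x) = 0" by (rule orth[OF xt XT UT])
  have "weyl M g nabla X (e a) (e a) U x = g x (curvature M nabla X (e a) (e a) x) (U x)
      - (Ric - g x (X x) (e a x) * ricci M g nabla (e a) U x) / (real n - 2)"
    if a: "a \<in> {1..p}" for a
    using orth[OF xt frame_in[OF e x a] UT] frame_metric[OF e x a a] \<open>n = DIM('e)\<close>
    by (simp add: weyl_def Let_def gXU Ric_def)
  then have "(\<Sum>a=1..p. weyl M g nabla X (e a) (e a) U x)
      = (\<Sum>a=1..p. g x (curvature M nabla X (e a) (e a) x) (U x)
      - (Ric - g x (X x) (e a x) * ricci M g nabla (e a) U x) / (real n - 2))"
    by (intro sum.cong) auto
  also have "\<dots> = A - (real p * Ric
      - (\<Sum>a=1..p. g x (X x) (e a x) * ricci M g nabla (e a) U x)) / (real n - 2)"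
    by (simp add: A_def sum_subtractf sum_divide_distrib[symmetric])
  also have "(\<Sum>a=1..p. g x (X x) (e a x) * ricci M g nabla (e a) U x) = Ric"
    unfolding Ric_def by (rule ricci_subframe_expansion[OF F[unfolded dim] e X XT U x, symmetric])
  finally have "(real n - 2) * (\<Sum>a=1..p. weyl M g nabla X (e a) (e a) U x)
      = (real q - 1) * A - (real p - 1) * B"
    using assms(6-8) by (simp add: Ric field_simps)
  also have "\<dots> = (real p - 1) * (real q - 1) * ext_deriv M \<theta> X U x"
    unfolding A B d\<theta> by (simp add: algebra_simps)
  finally have "(real n - 2) * (\<Sum>a=1..p. weyl M g nabla X (e a) (e a) U x)
      = ((real p - 1) * (real q - 1)) * ext_deriv M \<theta> X U x" .
  moreover have "(real p - 1) * (real q - 1) \<noteq> 0" using assms(6,7) by simp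
  ultimately show ?thesis by simp
qed

end
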